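(* Let $\mathcal{S}_1,\dots,\mathcal{S}_k$ be linear subspaces of $\mathbb{C}^{n\times n}$, let $F_j\in\mathcal{S}_j$ and let $f_j:\mathbb{C}\to\mathbb{C}$ be scalar functions for $j=1,\dots,k$, and let $F(\lambda)=\sum_{j=1}^k f_j(\lambda)F_j$. Let $(V,\Lambda)$ be approximate eigenpairs, i.e. $V=[\hat v_1\ \cdots\ \hat v_p]\in\mathbb{C}^{n\times p}$ with nonzero columns and $\Lambda=\mathrm{diag}(\hat\lambda_1,\dots,\hat\lambda_p)\in\mathbb{C}^{p\times p}$, let $R=\sum_{j=1}^k F_jVf_j(\Lambda)$, and let $G\in\mathbb{C}^{p\times k}$ have entries $G_{ij}=f_j(\hat\lambda_i)$. Then the structured backward error $\eta_{\mathcal{S}}$ (defined in the context) is equal to $$\eta_{\mathcal{S}}=\left\|\left[\left((G\odot^T V^T)\otimes I_n\right)P\right]^\dagger r\right\|_2,\qquad r:=\mathrm{vec}(R),$$ where $P$ is the block diagonal matrix of orthonormal bases of the $\mathcal{S}_j$ defined in the context. In particular, $$\eta_{\mathcal{S}}\le\sigma_{\min}\left(\left((G\odot^T V^T)\otimes I_n\right)P\right)^{-1}\|R\|_F .$$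
   Context: The structured backward error is $$\eta_{\mathcal{S}}:=\min\Big\{\|[\delta F_1,\dots,\delta F_k]\|_F\ :\ \sum_{j=1}^k(F_j+\delta F_j)Vf_j(\Lambda)=0,\ \delta F_j\in\mathcal{S}_j\text{ for } j=1,\dots,k\Big\}.$$ For each $j$, $P^{(1,j)},\dots,P^{(d_j,j)}$ is a basis of $\mathcal{S}_j$ that is orthonormal with respect to the Frobenius inner product; $P^{(j)}=[\mathrm{vec}(P^{(1,j)}),\dots,\mathrm{vec}(P^{(d_j,j)})]\in\mathbb{C}^{n^2\times d_j}$, and $P$ is the (rectangular) block diagonal matrix with diagonal blocks $P^{(1)},\dots,P^{(k)}$. The Khatri-Rao transpose product $A\odot^T B$ of a $p\times k$ matrix $A$ and a $p\times n$ matrix $B$ is the $p\times kn$ matrix whose $i$-th row is the Kronecker product of the $i$-th row of $A$ with the $i$-th row of $B$; so the $i$-th row of $G\odot^T V^T$ is $[f_1(\hat\lambda_i)\hat v_i^T,\dots,f_k(\hat\lambda_i)\hat v_i^T]$. Here $T$ is transposition without conjugation, $\mathrm{vec}$ stacks columns, $\otimes$ is the Kronecker product, $\dagger$ is the Moore-Penrose pseudoinverse, $f_j(\Lambda)=\mathrm{diag}(f_j(\hat\lambda_1),\dots,f_j(\hat\lambda_p))$, and $\sigma_{\min}$ is the smallest singular value; when it is zero the right-hand side of the last bound is read as $+\infty$ (the bound is then void). *)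

theory Defs
  imports
    "Jordan_Normal_Form.Schur_Decomposition"
    "Jordan_Normal_Form.VS_Connect"
begin

text \<open>
  Matrices are the carrier-based ones of \<open>Jordan_Normal_Form\<close>. All families and entries are indexed
  from 0, so that \<open>j = 1, \<dots>, k\<close> becomes \<open>j < k\<close>; the values of a family at \<open>j \<ge> k\<close> never matter.
\<close>

section \<open>Norms, vectorisation, and matrix products\<close>

definition vec_norm2 :: "complex vec \<Rightarrow> real" where
  "vec_norm2 v = sqrt (\<Sum>i<dim_vec v. (cmod (v $ i))\<^sup>2)"

definition frob_norm :: "complex mat \<Rightarrow> real" where
  "frob_norm A = sqrt (\<Sum>i<dim_row A. \<Sum>j<dim_col A. (cmod (A $$ (i, j)))\<^sup>2)"

definition frob_inner :: "complex mat \<Rightarrow> complex mat \<Rightarrow> complex" where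
  "frob_inner A B = (\<Sum>i<dim_row A. \<Sum>j<dim_col A. A $$ (i, j) * cnj (B $$ (i, j)))"

text \<open>Column stacking: entry \<open>(i, j)\<close> goes to position \<open>j * dim_row A + i\<close>.\<close>

definition vectorize :: "complex mat \<Rightarrow> complex vec" where
  "vectorize A = Matrix.vec (dim_row A * dim_col A)
     (\<lambda>l. A $$ (l mod dim_row A, l div dim_row A))"

definition kronecker :: "complex mat \<Rightarrow> complex mat \<Rightarrow> complex mat" where
  "kronecker A B = Matrix.mat (dim_row A * dim_row B) (dim_col A * dim_col B)
     (\<lambda>(i, j). A $$ (i div dim_row B, j div dim_col B) * B $$ (i mod dim_row B, j mod dim_col B))"

text \<open>Row \<open>i\<close> is the Kronecker product of row \<open>i\<close> of \<open>A\<close> with row \<open>i\<close> of \<open>B\<close>; meant for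
  \<open>dim_row A = dim_row B\<close>.\<close>

definition khatri_rao_T :: "complex mat \<Rightarrow> complex mat \<Rightarrow> complex mat" where
  "khatri_rao_T A B = Matrix.mat (dim_row A) (dim_col A * dim_col B)
     (\<lambda>(i, j). A $$ (i, j div dim_col B) * B $$ (i, j mod dim_col B))"

text \<open>The block row \<open>[A\<^sub>0, \<dots>, A\<^bsub>k-1\<^esub>]\<close> of \<open>n \<times> n\<close> blocks.\<close>

definition block_row :: "nat \<Rightarrow> nat \<Rightarrow> (nat \<Rightarrow> complex mat) \<Rightarrow> complex mat" where
  "block_row n k A = Matrix.mat n (k * n) (\<lambda>(i, c). A (c div n) $$ (i, c mod n))"

section \<open>Pseudoinverse and smallest singular value\<close>

definition is_moore_penrose :: "complex mat \<Rightarrow> complex mat \<Rightarrow> bool" where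
  "is_moore_penrose A X \<longleftrightarrow>
     X \<in> carrier_mat (dim_col A) (dim_row A) \<and>
     A * X * A = A \<and> X * A * X = X \<and>
     mat_adjoint (A * X) = A * X \<and> mat_adjoint (X * A) = X * A"

definition pinv :: "complex mat \<Rightarrow> complex mat" where
  "pinv A = (THE X. is_moore_penrose A X)"

text \<open>
  An \<open>m \<times> d\<close> matrix has \<open>min m d\<close> singular values (counted with multiplicity): the square roots of
  the eigenvalues of the smaller of its two Gram matrices. Hence 0 is a singular value exactly if
  the rank is less than \<open>min m d\<close>. These eigenvalues are real and nonnegative. If \<open>m = 0\<close> or
  \<open>d = 0\<close> there are no singular values and \<open>sigma_min\<close> is unspecified.
\<close>

definition singular_values :: "complex mat \<Rightarrow> real set" where
  "singular_values A =
     (\<lambda>e. sqrt (Re e)) `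
       {e. eigenvalue (if dim_col A \<le> dim_row A then mat_adjoint A * A else A * mat_adjoint A) e}"

definition sigma_min :: "complex mat \<Rightarrow> real" where
  "sigma_min A = Min (singular_values A)"

section \<open>Structured backward error\<close>

text \<open>A list enumerating a Frobenius-orthonormal basis of the subspace \<open>S\<close> of the \<open>n \<times> n\<close> matrices
  (the orthonormality condition forces the list to be distinct).\<close>

definition orthonormal_basis :: "nat \<Rightarrow> complex mat set \<Rightarrow> complex mat list \<Rightarrow> bool" where
  "orthonormal_basis n S Bs \<longleftrightarrow>
     vectorspace.basis class_ring ((module_mat TYPE(complex) n n)\<lparr>carrier := S\<rparr>) (set Bs) \<and>
     (\<forall>a<length Bs. \<forall>b<length Bs. frob_inner (Bs ! a) (Bs ! b) = (if a = b then 1 else 0))"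

text \<open>\<open>F\<^sub>0 V f\<^sub>0(\<Lambda>) + \<dots> + F\<^bsub>k-1\<^esub> V f\<^bsub>k-1\<^esub>(\<Lambda>)\<close> for \<open>\<Lambda> = mat_diag p lam\<close>; the sum is taken in the
  space of \<open>n \<times> p\<close> matrices.\<close>

definition residual ::
  "nat \<Rightarrow> nat \<Rightarrow> nat \<Rightarrow> (nat \<Rightarrow> complex \<Rightarrow> complex) \<Rightarrow> complex mat \<Rightarrow> (nat \<Rightarrow> complex) \<Rightarrow>
   (nat \<Rightarrow> complex mat) \<Rightarrow> complex mat" where
  "residual n p k f V lam F =
     finsum (module_mat TYPE(complex) n p)
       (\<lambda>j. F j * V * mat_diag p (\<lambda>i. f j (lam i))) {..<k}"

definition perturbation_norms ::
  "nat \<Rightarrow> nat \<Rightarrow> nat \<Rightarrow> (nat \<Rightarrow> complex mat set) \<Rightarrow> (nat \<Rightarrow> complex \<Rightarrow> complex) \<Rightarrow>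
   complex mat \<Rightarrow> (nat \<Rightarrow> complex) \<Rightarrow> (nat \<Rightarrow> complex mat) \<Rightarrow> real set" where
  "perturbation_norms n p k S f V lam F =
     {frob_norm (block_row n k dF) | dF.
        residual n p k f V lam (\<lambda>j. F j + dF j) = 0\<^sub>m n p \<and> (\<forall>j<k. dF j \<in> S j)}"

text \<open>The minimum of a set of reals; meaningful only if the minimum is attained.\<close>

definition struct_backward_error ::
  "nat \<Rightarrow> nat \<Rightarrow> nat \<Rightarrow> (nat \<Rightarrow> complex mat set) \<Rightarrow> (nat \<Rightarrow> complex \<Rightarrow> complex) \<Rightarrow>
   complex mat \<Rightarrow> (nat \<Rightarrow> complex) \<Rightarrow> (nat \<Rightarrow> complex mat) \<Rightarrow> real" where
  "struct_backward_error n p k S f V lam F =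
     (LEAST x. x \<in> perturbation_norms n p k S f V lam F)"

definition basis_mat :: "nat \<Rightarrow> complex mat list \<Rightarrow> complex mat" where
  "basis_mat n Bs = mat_of_cols (n * n) (map vectorize Bs)"

end

theory Submission
  imports Defs "HOL-Analysis.L2_Norm" "Jordan_Normal_Form.Spectral_Radius"
begin

text \<open>
  Vectorising \<open>[\<delta>F\<^sub>0, \<dots>, \<delta>F\<^bsub>k-1\<^esub>]\<close> identifies the admissible perturbations with the range of \<open>P\<close>,
  and \<open>P\<close> is an isometry because the bases are orthonormal. Under this identification the constraint
  reads \<open>M x = -r\<close>, so the backward error is the least norm of a solution of this linear system. It is
  consistent because \<open>\<delta>F = -F\<close> is admissible, hence the minimum is attained at \<open>-M\<^sup>\<dagger> r\<close>.
  For the bound, the spectral theorem for the smaller Gram matrix of \<open>M\<close> gives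
  \<open>\<sigma> \<parallel>y\<parallel> \<le> \<parallel>M y\<parallel>\<close> if \<open>M\<close> is tall. If \<open>M\<close> is wide, it gives \<open>\<sigma> \<parallel>w\<parallel> \<le> \<parallel>M\<^sup>* w\<parallel>\<close>, which is combined
  with \<open>y = M\<^sup>\<dagger> r = M\<^sup>* w\<close> and \<open>\<parallel>y\<parallel>\<^sup>2 = \<langle>r, w\<rangle>\<close>.
\<close>

section \<open>Adjoints and the spectral theorem\<close>

lemma mat_adjoint_dims [simp]:
  "dim_row (mat_adjoint A) = dim_col A" "dim_col (mat_adjoint A) = dim_row A"
  by (simp_all add: mat_adjoint_def)

lemma mat_adjoint_carrier [simp]: "A \<in> carrier_mat m d \<Longrightarrow> mat_adjoint A \<in> carrier_mat d m"
  by (rule carrier_matI) simp_all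

lemma mat_adjoint_index [simp]:
  "i < dim_col A \<Longrightarrow> j < dim_row A \<Longrightarrow> mat_adjoint A $$ (i, j) = conjugate (A $$ (j, i))"
  by (simp add: mat_adjoint_def mat_of_rows_index)

lemma mat_adjoint_adjoint [simp]: "mat_adjoint (mat_adjoint A) = A"
  by (rule eq_matI) auto

lemma mat_adjoint_one [simp]: "mat_adjoint (1\<^sub>m n) = (1\<^sub>m n :: complex mat)"
  by (rule eq_matI) auto

lemma mat_adjoint_diag: "mat_adjoint (mat_diag n d) = mat_diag n (\<lambda>i. cnj (d i))"
  by (rule eq_matI) (auto simp: mat_diag_def)

lemma mat_adjoint_mult:
  fixes A B :: "complex mat"
  assumes "A \<in> carrier_mat m d" "B \<in> carrier_mat d q"
  shows "mat_adjoint (A * B) = mat_adjoint B * mat_adjoint A"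
proof (rule eq_matI)
  fix i j assume "i < dim_row (mat_adjoint B * mat_adjoint A)" "j < dim_col (mat_adjoint B * mat_adjoint A)"
  then show "mat_adjoint (A * B) $$ (i, j) = (mat_adjoint B * mat_adjoint A) $$ (i, j)"
    using assms by (simp add: scalar_prod_def mult.commute)
qed (use assms in auto)

lemma mat_adjoint_four_block_diag:
  fixes A D :: "complex mat"
  assumes "A \<in> carrier_mat a b" "D \<in> carrier_mat c d"
  shows "mat_adjoint (four_block_mat A (0\<^sub>m a d) (0\<^sub>m c b) D)
    = four_block_mat (mat_adjoint A) (0\<^sub>m b c) (0\<^sub>m d a) (mat_adjoint D)"
  by (rule eq_matI) (use assms in auto)

text \<open>The off-diagonal blocks stay zero, so only the products of the diagonal blocks remain.
  This drives the deflation step of the spectral theorem and, later, the isometry of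
  \<open>P\<close>.\<close>

lemma mult_four_block_diag:
  fixes A D :: "'a :: semiring_1 mat"
  assumes "A \<in> carrier_mat a b" "D \<in> carrier_mat c d" "A' \<in> carrier_mat b a'" "D' \<in> carrier_mat d d'"
  shows "four_block_mat A (0\<^sub>m a d) (0\<^sub>m c b) D * four_block_mat A' (0\<^sub>m b d') (0\<^sub>m d a') D'
    = four_block_mat (A * A') (0\<^sub>m a d') (0\<^sub>m c a') (D * D')"
  using assms by (subst mult_four_block_mat[of _ a b _ d _ c _ _ a' _ d']) auto

text \<open>An exchange of two finite sums. As \<open>\<bullet>c\<close> conjugates its second
  argument, moving \<open>A\<close> across it produces the adjoint.\<close>

lemma cscalar_prod_adjoint:
  fixes A :: "complex mat"
  assumes "A \<in> carrier_mat m d" "x \<in> carrier_vec d" "y \<in> carrier_vec m"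
  shows "(A *\<^sub>v x) \<bullet>c y = x \<bullet>c (mat_adjoint A *\<^sub>v y)"
proof -
  have "(A *\<^sub>v x) \<bullet>c y = (\<Sum>i<m. \<Sum>j<d. A $$ (i, j) * x $ j * cnj (y $ i))"
    using assms by (simp add: scalar_prod_def sum_distrib_right flip: atLeast0LessThan)
  also have "\<dots> = (\<Sum>j<d. \<Sum>i<m. A $$ (i, j) * x $ j * cnj (y $ i))"
    by (rule sum.swap)
  also have "\<dots> = x \<bullet>c (mat_adjoint A *\<^sub>v y)"
    using assms by (simp add: scalar_prod_def sum_distrib_left mult_ac flip: atLeast0LessThan)
  finally show ?thesis .
qed

section \<open>Euclidean norm, Cauchy-Schwarz and isometries\<close>

lemma vec_norm2_nonneg [simp]: "vec_norm2 v \<ge> 0"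
  by (simp add: vec_norm2_def sum_nonneg)

lemma vec_norm2_zero [simp]: "vec_norm2 (0\<^sub>v n) = 0"
  by (simp add: vec_norm2_def)

lemma vec_norm2_uminus [simp]: "vec_norm2 (- v) = vec_norm2 v"
  by (simp add: vec_norm2_def)

lemma vec_norm2_square: "(vec_norm2 v)\<^sup>2 = (\<Sum>i<dim_vec v. (cmod (v $ i))\<^sup>2)"
  by (simp add: vec_norm2_def sum_nonneg)

lemma cscalar_prod_self: "v \<bullet>c v = complex_of_real ((vec_norm2 v)\<^sup>2)"
  unfolding vec_norm2_square
  by (simp add: scalar_prod_def complex_norm_square[symmetric] atLeast0LessThan flip: of_real_power of_real_sum)

lemma vec_norm2_eq_0: "v \<in> carrier_vec n \<Longrightarrow> vec_norm2 v = 0 \<longleftrightarrow> v = 0\<^sub>v n"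
  using conjugate_square_eq_0_vec[of v n] cscalar_prod_self[of v] by auto

text \<open>Cauchy-Schwarz: the triangle inequality passes to the moduli of the entries, where the
  real inequality for \<open>L2_set\<close> applies.\<close>

lemma cscalar_prod_le:
  assumes "dim_vec v = dim_vec w"
  shows "cmod (v \<bullet>c w) \<le> vec_norm2 v * vec_norm2 w"
proof -
  have "cmod (v \<bullet>c w) \<le> (\<Sum>i<dim_vec w. \<bar>cmod (v $ i)\<bar> * \<bar>cmod (w $ i)\<bar>)"
    by (auto simp: scalar_prod_def atLeast0LessThan norm_mult intro!: order.trans[OF norm_sum])
  also have "\<dots> \<le> L2_set (\<lambda>i. cmod (v $ i)) {..<dim_vec w} * L2_set (\<lambda>i. cmod (w $ i)) {..<dim_vec w}"
    by (rule L2_set_mult_ineq)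
  finally show ?thesis
    using assms by (simp add: L2_set_def vec_norm2_def)
qed

text \<open>Makes norms of images readable from the Gram matrix; isometries, orthogonal projections
  and singular values are all treated through this identity.\<close>

lemma vec_norm2_mult_square:
  assumes "A \<in> carrier_mat m d" "x \<in> carrier_vec d"
  shows "complex_of_real ((vec_norm2 (A *\<^sub>v x))\<^sup>2) = x \<bullet>c ((mat_adjoint A * A) *\<^sub>v x)"
proof -
  have "complex_of_real ((vec_norm2 (A *\<^sub>v x))\<^sup>2) = (A *\<^sub>v x) \<bullet>c (A *\<^sub>v x)"
    by (rule cscalar_prod_self[symmetric])
  also have "\<dots> = x \<bullet>c (mat_adjoint A *\<^sub>v (A *\<^sub>v x))"
    by (rule cscalar_prod_adjoint) (use assms in auto)
  also have "mat_adjoint A *\<^sub>v (A *\<^sub>v x) = (mat_adjoint A * A) *\<^sub>v x"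
    by (rule assoc_mult_mat_vec[symmetric]) (use assms in auto)
  finally show ?thesis .
qed

lemma vec_norm2_isometry:
  assumes "A \<in> carrier_mat m d" "x \<in> carrier_vec d" "mat_adjoint A * A = 1\<^sub>m d"
  shows "vec_norm2 (A *\<^sub>v x) = vec_norm2 x"
proof -
  have "complex_of_real ((vec_norm2 (A *\<^sub>v x))\<^sup>2) = complex_of_real ((vec_norm2 x)\<^sup>2)"
    using vec_norm2_mult_square[OF assms(1,2)] assms by (simp add: cscalar_prod_self)
  then show ?thesis
    by (simp only: of_real_eq_iff power2_eq_iff_nonneg[OF vec_norm2_nonneg vec_norm2_nonneg])
qed

section \<open>Unitary diagonalisation of Hermitian matrices\<close>

lemma exists_unitary_first_col:
  fixes v :: "complex vec"
  assumes v: "v \<in> carrier_vec n" "v \<noteq> 0\<^sub>v n"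
  obtains W c where "W \<in> carrier_mat n n" "mat_adjoint W * W = 1\<^sub>m n" "col W 0 = c \<cdot>\<^sub>v v"
proof -
  interpret cof_vec_space n "TYPE(complex)" .
  \<comment> \<open>Complete \<open>v\<close> to a basis and orthogonalise. Gram-Schmidt leaves the
    first vector unchanged, so \<open>ws\<close> starts with \<open>v\<close>.\<close>
  define ws where "ws = gram_schmidt n (basis_completion v)"
  note bc = basis_completion[OF v]
  have ws: "set ws \<subseteq> carrier_vec n" "corthogonal ws" "length ws = n"
    using gram_schmidt_result[OF bc(2,4,5) refl, folded ws_def] bc(6) by auto
  have n: "n > 0" using v by (cases n) auto
  obtain vs where vs: "basis_completion v = v # vs"
    using bc(6,7) n by (cases "basis_completion v") auto
  have hd: "ws ! 0 = v"
    using gram_schmidt_hd[OF v(1), of vs] ws(3) n by (metis hd_conv_nth list.size(3) less_numeral_extra(3) ws_def vs)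
  have wsc: "ws ! i \<in> carrier_vec n" if "i < n" for i
    using ws that by auto
  \<comment> \<open>\<open>corthogonal\<close> also says that the product of each member with itself
    is nonzero.\<close>
  have norm0: "vec_norm2 (ws ! i) \<noteq> 0" if "i < n" for i
    using corthogonalD[OF ws(2), of i i] that ws(3) cscalar_prod_self[of "ws ! i"] by auto
  \<comment> \<open>The members of \<open>ws\<close> are orthogonal but not normalised. Dividing by
    their lengths makes \<open>W\<close> unitary and turns its first column into a multiple of
    \<open>v\<close>.\<close>
  define c where "c i = complex_of_real (inverse (vec_norm2 (ws ! i)))" for i
  define W where "W = mat_of_cols n (map (\<lambda>i. c i \<cdot>\<^sub>v ws ! i) [0..<n])"
  have W: "W \<in> carrier_mat n n" by (rule carrier_matI) (simp_all add: W_def)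
  have col: "col W i = c i \<cdot>\<^sub>v ws ! i" if "i < n" for i
    using that wsc[OF that] by (simp add: W_def)
  have "mat_adjoint W * W = 1\<^sub>m n"
  proof (rule eq_matI)
    fix i j assume "i < dim_row (1\<^sub>m n :: complex mat)" "j < dim_col (1\<^sub>m n :: complex mat)"
    then have ij: "i < n" "j < n" by auto
    have "(mat_adjoint W * W) $$ (i, j) = conjugate (col W i) \<bullet> col W j"
      using W ij by (auto simp: scalar_prod_def intro!: sum.cong)
    also have "\<dots> = col W j \<bullet>c col W i"
      by (rule conjugate_vec_sprod_comm[of _ n, symmetric]) (simp_all add: col wsc ij)
    also have "\<dots> = c j * (cnj (c i) * (ws ! j \<bullet>c ws ! i))"
      using wsc[OF ij(1)] wsc[OF ij(2)] ij
      by (simp add: col conjugate_smult_vec scalar_prod_smult_distrib[of _ n] smult_scalar_prod_distrib[of _ n])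
    also have "\<dots> = 1\<^sub>m n $$ (i, j)"
    proof (cases "i = j")
      case True
      then show ?thesis
        using ij norm0[of i]
        by (simp add: cscalar_prod_self c_def power2_eq_square field_simps)
    next
      case False
      then show ?thesis using ij corthogonalD[OF ws(2), of j i] ws(3) by auto
    qed
    finally show "(mat_adjoint W * W) $$ (i, j) = 1\<^sub>m n $$ (i, j)" .
  qed (use W in auto)
  then show ?thesis
    using that[OF W] col[OF n] hd by simp
qed

lemma unitary_other_side:
  fixes U :: "complex mat"
  assumes "U \<in> carrier_mat n n" "mat_adjoint U * U = 1\<^sub>m n"
  shows "U * mat_adjoint U = 1\<^sub>m n"
  using mat_mult_left_right_inverse[OF _ assms(1) assms(2)] assms(1) by simp

text \<open>Deflation by induction on the size: a unitary \<open>W\<close> whose first column is an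
  eigenvector turns \<open>A\<close> into a block diagonal matrix consisting of the eigenvalue and a
  smaller Hermitian block. The diagonal is stated with real \<open>d\<close> so that entries can
  later be compared and square roots taken.\<close>

lemma hermitian_diagonalization:
  fixes A :: "complex mat"
  assumes "A \<in> carrier_mat n n" "mat_adjoint A = A"
  shows "\<exists>U d. U \<in> carrier_mat n n \<and> mat_adjoint U * U = 1\<^sub>m n \<and> A = U * mat_diag n (\<lambda>i. complex_of_real (d i)) * mat_adjoint U"
  using assms
proof (induction n arbitrary: A)
  case 0
  then show ?case
    by (intro exI[of _ "0\<^sub>m 0 0"] exI[of _ "\<lambda>_. 0"]) (auto intro!: eq_matI)
next
  case (Suc n)
  note A = Suc.prems(1) and herm = Suc.prems(2)
  \<comment> \<open>The size is positive here, and over the complex numbers such a matrix has an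
    eigenvalue.\<close>
  obtain e where "e \<in> spectrum A"
    using spectrum_non_empty[OF A] by auto
  then obtain v where "eigenvector A v e"
    by (auto simp: spectrum_def eigenvalue_def)
  then have v: "v \<in> carrier_vec (Suc n)" "v \<noteq> 0\<^sub>v (Suc n)" "A *\<^sub>v v = e \<cdot>\<^sub>v v"
    using A by (auto simp: eigenvector_def)
  obtain W c where W: "W \<in> carrier_mat (Suc n) (Suc n)" "mat_adjoint W * W = 1\<^sub>m (Suc n)"
      and col: "col W 0 = c \<cdot>\<^sub>v v"
    using exists_unitary_first_col[OF v(1,2)] by metis
  note WW = unitary_other_side[OF W]
  define C where "C = mat_adjoint W * (A * W)"
  have C: "C \<in> carrier_mat (Suc n) (Suc n)"
    unfolding C_def using W(1) A by (intro mult_carrier_mat[of _ _ "Suc n"]) auto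
  have hermC: "mat_adjoint C = C"
    using W A herm
    by (simp add: C_def mat_adjoint_mult[of _ "Suc n" "Suc n" _ "Suc n"] assoc_mult_mat[of _ "Suc n" "Suc n" _ "Suc n" _ "Suc n"])
  have "A *\<^sub>v (c \<cdot>\<^sub>v v) = e \<cdot>\<^sub>v (c \<cdot>\<^sub>v v)"
    unfolding mult_mat_vec[OF A v(1)] v(3) by (simp add: smult_smult_assoc mult.commute)
  then have Acol: "col (A * W) 0 = e \<cdot>\<^sub>v col W 0"
    using col_mult2[OF A W(1), of 0] by (simp add: col)
  \<comment> \<open>The first column of \<open>A * W\<close> is \<open>e\<close> times that of
    \<open>W\<close>, and unitarity sends the latter to the first unit vector.\<close>
  have C0: "C $$ (i, 0) = (if i = 0 then e else 0)" if "i < Suc n" for i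
  proof -
    have "C $$ (i, 0) = row (mat_adjoint W) i \<bullet> col (A * W) 0"
      using W A that by (simp add: C_def)
    also have "\<dots> = e * (row (mat_adjoint W) i \<bullet> col W 0)"
      unfolding Acol
    proof (rule scalar_prod_smult_distrib)
      show "row (mat_adjoint W) i \<in> carrier_vec (Suc n)" "col W 0 \<in> carrier_vec (Suc n)"
        using W(1) row_carrier[of "mat_adjoint W" i] col_dim[of W 0] by (metis carrier_matD(1) mat_adjoint_dims(2))+
    qed
    also have "row (mat_adjoint W) i \<bullet> col W 0 = (mat_adjoint W * W) $$ (i, 0)"
      using W(1) that by simp
    finally show ?thesis using that unfolding W(2) by simp
  qed
  \<comment> \<open>Being Hermitian carries the zeros of the first column over to the first row; the
    corner entry then equals its own conjugate, so \<open>e\<close> is real.\<close>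
  have C0': "C $$ (0, j) = (if j = 0 then cnj e else 0)" if "j < Suc n" for j
    using C0[OF that] arg_cong[OF hermC, of "\<lambda>M. M $$ (0, j)"] C that by auto
  have cnj_e: "cnj e = e"
    using C0'[of 0] C0[of 0] by simp
  then have e: "e = complex_of_real (Re e)"
    by (simp add: complex_eq_iff)
  define B where "B = Matrix.mat n n (\<lambda>(i, j). C $$ (Suc i, Suc j))"
  have B: "B \<in> carrier_mat n n" by (simp add: B_def)
  have "mat_adjoint B = B"
  proof (rule eq_matI)
    fix i j assume "i < dim_row B" "j < dim_col B"
    then have ij: "i < n" "j < n" by (auto simp: B_def)
    then show "mat_adjoint B $$ (i, j) = B $$ (i, j)"
      using arg_cong[OF hermC, of "\<lambda>M. M $$ (Suc i, Suc j)"] C by (simp add: B_def)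
  qed (use B in auto)
  from Suc.IH[OF B this] obtain U d where U: "U \<in> carrier_mat n n" "mat_adjoint U * U = 1\<^sub>m n"
      and BU: "B = U * mat_diag n (\<lambda>i. complex_of_real (d i)) * mat_adjoint U" by auto
  let ?blk = "\<lambda>X Y. four_block_mat X (0\<^sub>m 1 n) (0\<^sub>m n 1) Y :: complex mat"
  define U' where "U' = ?blk (1\<^sub>m 1) U"
  \<comment> \<open>The new eigenvalue takes position 0 and those of the smaller block move up by
    one.\<close>
  define d' where "d' i = (if i = 0 then Re e else d (i - 1))" for i
  have U': "U' \<in> carrier_mat (Suc n) (Suc n)"
    using four_block_carrier_mat[OF one_carrier_mat[of 1] U(1)] by (simp add: U'_def)
  have adjU': "mat_adjoint U' = ?blk (1\<^sub>m 1) (mat_adjoint U)"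
    using mat_adjoint_four_block_diag[of "1\<^sub>m 1" 1 1 U n n] U by (simp add: U'_def)
  have uU': "mat_adjoint U' * U' = 1\<^sub>m (Suc n)"
    using mult_four_block_diag[of "1\<^sub>m 1" 1 1 "mat_adjoint U" n n "1\<^sub>m 1" 1 U n] U
    unfolding adjU' by (simp add: U'_def)
  have diag: "mat_diag (Suc n) (\<lambda>i. complex_of_real (d' i)) = ?blk (mat_diag 1 (\<lambda>_. e)) (mat_diag n (\<lambda>i. complex_of_real (d i)))"
    by (rule eq_matI) (use e in \<open>auto simp: mat_diag_def d'_def\<close>)
  have "C = ?blk (mat_diag 1 (\<lambda>_. e)) B"
    by (rule eq_matI) (use C B C0 C0' cnj_e in \<open>auto simp: mat_diag_def B_def\<close>)
  also have "\<dots> = U' * mat_diag (Suc n) (\<lambda>i. complex_of_real (d' i)) * mat_adjoint U'"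
  proof -
    let ?D1 = "mat_diag 1 (\<lambda>_. e)" and ?D = "mat_diag n (\<lambda>i. complex_of_real (d i))"
    have "U' * mat_diag (Suc n) (\<lambda>i. complex_of_real (d' i)) = ?blk (1\<^sub>m 1 * ?D1) (U * ?D)"
      unfolding U'_def diag by (rule mult_four_block_diag) (use U in auto)
    moreover have "?blk (1\<^sub>m 1 * ?D1) (U * ?D) * mat_adjoint U'
        = ?blk (1\<^sub>m 1 * ?D1 * 1\<^sub>m 1) (U * ?D * mat_adjoint U)"
      unfolding adjU' by (rule mult_four_block_diag) (use U in \<open>auto simp: mult_carrier_mat[of _ n n] mult_carrier_mat[of _ "Suc 0" "Suc 0"]\<close>)
    moreover have "1\<^sub>m 1 * ?D1 * 1\<^sub>m 1 = ?D1"
      by (metis left_mult_one_mat mat_diag_dim right_mult_one_mat)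
    ultimately show ?thesis by (simp only: BU)
  qed
  finally have CU: "C = U' * mat_diag (Suc n) (\<lambda>i. complex_of_real (d' i)) * mat_adjoint U'" .
  have dc: "mat_diag (Suc n) (\<lambda>i. complex_of_real (d' i)) \<in> carrier_mat (Suc n) (Suc n)" by simp
  note assoc = assoc_mult_mat[of _ "Suc n" "Suc n" _ "Suc n" _ "Suc n"]
  \<comment> \<open>Undo the conjugation by \<open>W\<close>; the diagonalising unitary of
    \<open>A\<close> becomes \<open>W * U'\<close>.\<close>
  have "A = (W * mat_adjoint W) * A * (W * mat_adjoint W)"
    using A by (simp add: WW)
  also have "\<dots> = W * C * mat_adjoint W"
    using A W by (simp add: C_def assoc mult_carrier_mat[of _ "Suc n" "Suc n"])
  also have "\<dots> = (W * U') * mat_diag (Suc n) (\<lambda>i. complex_of_real (d' i)) * mat_adjoint (W * U')"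
    using W U' by (simp add: CU assoc mult_carrier_mat[of _ "Suc n" "Suc n"]
      mat_adjoint_mult[of _ "Suc n" "Suc n" _ "Suc n"])
  finally have "A = (W * U') * mat_diag (Suc n) (\<lambda>i. complex_of_real (d' i)) * mat_adjoint (W * U')" .
  moreover have "mat_adjoint (W * U') * (W * U') = 1\<^sub>m (Suc n)"
  proof -
    have "mat_adjoint (W * U') * (W * U') = mat_adjoint U' * ((mat_adjoint W * W) * U')"
      using W(1) U' by (simp add: assoc mult_carrier_mat[of _ "Suc n" "Suc n"]
        mat_adjoint_mult[of _ "Suc n" "Suc n" _ "Suc n"])
    then show ?thesis using U' by (simp add: W(2) uU')
  qed
  ultimately show ?case
    using W(1) U' by (intro exI[of _ "W * U'"] exI[of _ d']) simp
qed

section \<open>The Moore-Penrose pseudoinverse\<close>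

text \<open>Both candidates give the same projections: \<open>A * X = A * Y\<close> and
  \<open>X * A = Y * A\<close>. Then
  \<open>X = X * A * X = Y * A * X = Y * A * Y = Y\<close>.\<close>

lemma is_moore_penrose_unique:
  assumes X: "is_moore_penrose A X" and Y: "is_moore_penrose A Y"
  shows "X = Y"
proof -
  define m d where "m = dim_row A" and "d = dim_col A"
  have A: "A \<in> carrier_mat m d" by (simp add: m_def d_def)
  have Xc: "X \<in> carrier_mat d m" and Yc: "Y \<in> carrier_mat d m"
    using X Y by (auto simp: is_moore_penrose_def m_def d_def)
  have X': "A * X * A = A" "X * A * X = X" "mat_adjoint (A * X) = A * X" "mat_adjoint (X * A) = X * A"
    and Y': "A * Y * A = A" "Y * A * Y = Y" "mat_adjoint (A * Y) = A * Y" "mat_adjoint (Y * A) = Y * A"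
    using X Y by (auto simp: is_moore_penrose_def)
  have AX: "A * X = A * Y"
  proof -
    \<comment> \<open>Write \<open>A\<close> as \<open>A * Y * A\<close> and take adjoints: the two
      Hermitian factors \<open>A * Y\<close> and \<open>A * X\<close> change places, after which
      \<open>A * X * A = A\<close> removes \<open>X\<close>.\<close>
    have "A * X = mat_adjoint ((A * Y * A) * X)" by (simp add: X'(3) Y'(1))
    also have "(A * Y * A) * X = (A * Y) * (A * X)"
      by (rule assoc_mult_mat) (use A Xc Yc in auto)
    also have "mat_adjoint \<dots> = (A * X) * (A * Y)"
      using mat_adjoint_mult[of "A * Y" m m "A * X" m] A Xc Yc by (simp add: X'(3) Y'(3))
    also have "\<dots> = (A * X * A) * Y"
      by (rule assoc_mult_mat[symmetric]) (use A Xc Yc in auto)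
    finally show ?thesis by (simp add: X'(1))
  qed
  have XA: "X * A = Y * A"
  proof -
    have "X * A = mat_adjoint (X * (A * Y * A))" by (simp add: X'(4) Y'(1))
    also have "X * (A * Y * A) = X * (A * (Y * A))"
      using A Xc Yc by (simp add: assoc_mult_mat[of _ m d _ m _ d])
    also have "\<dots> = (X * A) * (Y * A)"
      by (rule assoc_mult_mat[symmetric]) (use A Xc Yc in auto)
    also have "mat_adjoint \<dots> = (Y * A) * (X * A)"
      using mat_adjoint_mult[of "X * A" d d "Y * A" d] A Xc Yc by (simp add: X'(4) Y'(4))
    also have "\<dots> = Y * (A * (X * A))"
      by (rule assoc_mult_mat) (use A Xc Yc in auto)
    also have "A * (X * A) = A * X * A"
      by (rule assoc_mult_mat[symmetric]) (use A Xc Yc in auto)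
    finally show ?thesis by (simp add: X'(1))
  qed
  have "X = Y * A * X" using X'(2) by (simp add: XA)
  also have "\<dots> = Y * (A * X)" by (rule assoc_mult_mat) (use A Xc Yc in auto)
  also have "\<dots> = Y * A * Y"
    unfolding AX by (rule assoc_mult_mat[symmetric]) (use A Xc Yc in auto)
  finally show ?thesis by (simp add: Y'(2))
qed

text \<open>The diagonal of the Gram matrix holds the squared lengths of the columns. This is what
  allows cancelling \<open>A\<^sup>*\<close> on the left.\<close>

lemma mat_adjoint_mult_self_eq_0:
  fixes A :: "complex mat"
  assumes "A \<in> carrier_mat m d" "mat_adjoint A * A = 0\<^sub>m d d"
  shows "A = 0\<^sub>m m d"
proof (rule eq_matI)
  fix i j assume "i < dim_row (0\<^sub>m m d :: complex mat)" "j < dim_col (0\<^sub>m m d :: complex mat)"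
  then have ij: "i < m" "j < d" by auto
  have "(mat_adjoint A * A) $$ (j, j) = conjugate (col A j) \<bullet> col A j"
    using assms(1) ij by (auto simp: scalar_prod_def intro!: sum.cong)
  also have "\<dots> = col A j \<bullet>c col A j"
    by (rule conjugate_vec_sprod_comm[of _ m, symmetric]) (use assms in auto)
  finally have "col A j \<bullet>c col A j = 0"
    using assms ij by simp
  then have "col A j = 0\<^sub>v m"
    using conjugate_square_eq_0_vec[of "col A j" m] assms(1) by auto
  then show "A $$ (i, j) = 0\<^sub>m m d $$ (i, j)"
    using ij assms(1) by (metis carrier_matD index_col index_zero_mat(1) index_zero_vec(1))
qed (use assms in auto)

text \<open>If \<open>A\<^sup>* A = U D U\<^sup>*\<close>, the pseudoinverse is \<open>U D\<^sup>+ U\<^sup>* A\<^sup>*\<close>, where \<open>D\<^sup>+\<close> inverts the nonzero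
  entries of \<open>D\<close>; Isabelle's \<open>inverse 0 = 0\<close> makes \<open>D\<^sup>+\<close> the entrywise inverse.\<close>

lemma is_moore_penrose_exists:
  fixes A :: "complex mat"
  shows "\<exists>X. is_moore_penrose A X"
proof -
  define m d where "m = dim_row A" and "d = dim_col A"
  have A: "A \<in> carrier_mat m d" by (simp add: m_def d_def)
  define A' where "A' = mat_adjoint A"
  have A': "A' \<in> carrier_mat d m" using A by (simp add: A'_def)
  define H where "H = A' * A"
  have H: "H \<in> carrier_mat d d" using A A' by (simp add: H_def)
  have hermH: "mat_adjoint H = H"
    using mat_adjoint_mult[OF A' A] by (simp add: H_def A'_def)
  obtain U l where U: "U \<in> carrier_mat d d" "mat_adjoint U * U = 1\<^sub>m d"
      and HU: "H = U * mat_diag d (\<lambda>i. complex_of_real (l i)) * mat_adjoint U"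
    using hermitian_diagonalization[OF H hermH] by blast
  note mc = mult_carrier_mat[of _ d d _ d]
  note ass = assoc_mult_mat[of _ d d _ d _ d]
  \<comment> \<open>Matrices diagonalised by the same \<open>U\<close> multiply through their
    diagonals, so identities between \<open>H\<close> and \<open>L\<close> reduce to scalar
    ones.\<close>
  have conj: "(U * mat_diag d a * mat_adjoint U) * (U * mat_diag d b * mat_adjoint U)
      = U * mat_diag d (\<lambda>i. a i * b i) * mat_adjoint U" for a b
  proof -
    have "(U * mat_diag d a * mat_adjoint U) * (U * mat_diag d b * mat_adjoint U)
       = U * mat_diag d a * ((mat_adjoint U * U) * (mat_diag d b * mat_adjoint U))"
      using U(1) by (simp add: ass mc)
    also have "\<dots> = U * mat_diag d a * (mat_diag d b * mat_adjoint U)"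
      by (simp add: U mc left_mult_one_mat[of _ d d])
    also have "\<dots> = U * (mat_diag d a * mat_diag d b) * mat_adjoint U"
      using U(1) by (simp add: ass mc del: mat_diag_diag)
    finally show ?thesis by simp
  qed
  have adj: "mat_adjoint (U * mat_diag d a * mat_adjoint U) = U * mat_diag d (\<lambda>i. cnj (a i)) * mat_adjoint U" for a
    using U(1) by (simp add: mat_adjoint_mult[of _ d d _ d] mc ass mat_adjoint_diag)
  define L where "L = U * mat_diag d (\<lambda>i. complex_of_real (inverse (l i))) * mat_adjoint U"
  have L: "L \<in> carrier_mat d d" using U by (simp add: L_def mc)
  \<comment> \<open>The scalar Moore-Penrose identities; at \<open>x = 0\<close> they rest on
    \<open>inverse 0 = 0\<close>.\<close>
  have inv: "x * (inverse x * x) = x" "inverse x * (x * inverse x) = inverse x" for x :: complex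
    by (cases "x = 0"; simp)+
  have HLH: "H * (L * H) = H" "L * (H * L) = L" and comm: "H * L = L * H"
    by (simp_all add: HU L_def conj inv) (simp add: mult.commute)
  have hermL: "mat_adjoint L = L"
    by (simp add: L_def adj)
  have hermLH: "mat_adjoint (L * H) = L * H"
    using mat_adjoint_mult[OF L H] by (simp add: hermH hermL comm)
  define X where "X = L * A'"
  have X: "X \<in> carrier_mat d m" using L A' by (simp add: X_def)
  have XA: "X * A = L * H"
    unfolding X_def H_def by (rule assoc_mult_mat) (use L A A' in auto)
  \<comment> \<open>To pass from \<open>H * L * H = H\<close> to \<open>A * (L * H) = A\<close>:
    since \<open>H * E = 0\<close>, also
    \<open>(A * E)\<^sup>* * (A * E) = E\<^sup>* * H * E = 0\<close>, and therefore
    \<open>A * E = 0\<close>.\<close>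
  define E where "E = L * H - 1\<^sub>m d"
  have E: "E \<in> carrier_mat d d" using L H by (simp add: E_def mc minus_carrier_mat)
  have "H * E = 0\<^sub>m d d"
    using L H mult_minus_distrib_mat[of H d d "L * H" d "1\<^sub>m d"] by (simp add: E_def mc HLH)
  then have "mat_adjoint (A * E) * (A * E) = 0\<^sub>m d d"
    using A A' E by (simp add: mat_adjoint_mult[OF A E] A'_def[symmetric] H_def
      assoc_mult_mat[of _ d d _ m _ d] assoc_mult_mat[of _ d m _ d _ d])
  then have "A * E = 0\<^sub>m m d"
    by (rule mat_adjoint_mult_self_eq_0[rotated]) (use A E in auto)
  then have AE: "A * (L * H) - A = 0\<^sub>m m d"
    using A L H mult_minus_distrib_mat[of A m d "L * H" d "1\<^sub>m d"] by (simp add: E_def mc)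
  have ALH: "A * (L * H) = A"
  proof (rule eq_matI)
    fix i j assume "i < dim_row A" "j < dim_col A"
    then show "(A * (L * H)) $$ (i, j) = A $$ (i, j)"
      using arg_cong[OF AE, of "\<lambda>M. M $$ (i, j)"] A L H by (simp del: index_mult_mat(1))
  qed (use A L H in auto)
  have "A * X * A = A"
    using ALH XA assoc_mult_mat[OF A X A] by simp
  moreover have "X * A * X = X"
    unfolding XA unfolding X_def
    using assoc_mult_mat[of "L * H" d d L d A' m] L H A' by (simp add: mc HLH assoc_mult_mat[OF L H L])
  moreover have "mat_adjoint (A * X) = A * X"
    using mat_adjoint_mult[OF A X] mat_adjoint_mult[OF L A'] assoc_mult_mat[OF A L A']
    by (simp add: X_def hermL) (simp add: A'_def)
  moreover have "mat_adjoint (X * A) = X * A"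
    by (simp add: XA hermLH)
  ultimately have "is_moore_penrose A X"
    using X by (simp add: is_moore_penrose_def m_def d_def)
  then show ?thesis ..
qed

section \<open>The pseudoinverse as least-norm solver of consistent systems\<close>

lemma is_moore_penrose_pinv: "is_moore_penrose A (pinv A)"
  unfolding pinv_def using is_moore_penrose_exists is_moore_penrose_unique by (metis theI')

lemma pinv_carrier: "A \<in> carrier_mat m d \<Longrightarrow> pinv A \<in> carrier_mat d m"
  using is_moore_penrose_pinv[of A] by (auto simp: is_moore_penrose_def)

text \<open>\<open>A * pinv A\<close> fixes the range of \<open>A\<close>; hence the pseudoinverse
  solves every system whose right-hand side lies in that range.\<close>

lemma mult_pinv_image:
  assumes A: "A \<in> carrier_mat m d" and x: "x \<in> carrier_vec d"
  shows "A *\<^sub>v (pinv A *\<^sub>v (A *\<^sub>v x)) = A *\<^sub>v x"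
proof -
  have "A *\<^sub>v (pinv A *\<^sub>v (A *\<^sub>v x)) = (A * pinv A) *\<^sub>v (A *\<^sub>v x)"
    by (rule assoc_mult_mat_vec[symmetric]) (use A x pinv_carrier[OF A] in auto)
  also have "\<dots> = (A * pinv A * A) *\<^sub>v x"
    by (rule assoc_mult_mat_vec[symmetric]) (use A x pinv_carrier[OF A] in auto)
  finally show ?thesis
    using is_moore_penrose_pinv[of A] by (simp add: is_moore_penrose_def)
qed

text \<open>\<open>Q = pinv A * A\<close> is an orthogonal projection, hence
  \<open>\<parallel>Q x\<parallel>\<^sup>2 = \<langle>x, Q x\<rangle>\<close>, and Cauchy-Schwarz
  gives \<open>\<parallel>Q x\<parallel> \<le> \<parallel>x\<parallel>\<close>. With
  \<open>x\<close> ranging over the solutions of a system, this is minimality of the norm.\<close>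

lemma pinv_minimal_norm:
  assumes A: "A \<in> carrier_mat m d" and x: "x \<in> carrier_vec d"
  shows "vec_norm2 (pinv A *\<^sub>v (A *\<^sub>v x)) \<le> vec_norm2 x"
proof -
  define Q where "Q = pinv A * A"
  note X = pinv_carrier[OF A]
  have Q: "Q \<in> carrier_mat d d" "mat_adjoint Q = Q"
    using is_moore_penrose_pinv[of A] A X by (auto simp: Q_def is_moore_penrose_def)
  have "Q * Q = (pinv A * A * pinv A) * A"
    unfolding Q_def by (rule assoc_mult_mat[symmetric]) (use A X in auto)
  then have QQ: "Q * Q = Q"
    using is_moore_penrose_pinv[of A] by (simp add: Q_def is_moore_penrose_def)
  define y where "y = Q *\<^sub>v x"
  have y: "y \<in> carrier_vec d" using Q x by (simp add: y_def)
  have "complex_of_real ((vec_norm2 y)\<^sup>2) = x \<bullet>c y"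
    using vec_norm2_mult_square[OF Q(1) x] by (simp add: Q(2) QQ y_def)
  then have "(vec_norm2 y)\<^sup>2 = cmod (x \<bullet>c y)"
    by (metis norm_of_real abs_of_nonneg zero_le_power2)
  also have "\<dots> \<le> vec_norm2 x * vec_norm2 y"
    by (rule cscalar_prod_le) (use x y in auto)
  finally have "vec_norm2 y \<le> vec_norm2 x"
    by (cases "vec_norm2 y = 0") (auto simp: power2_eq_square less_le)
  then show ?thesis
    using assoc_mult_mat_vec[OF X A x] by (simp add: y_def Q_def)
qed

section \<open>The smallest singular value\<close>

lemma finite_singular_values: "finite (singular_values A)"
proof -
  let ?H = "if dim_col A \<le> dim_row A then mat_adjoint A * A else A * mat_adjoint A"
  have "?H \<in> carrier_mat (dim_row ?H) (dim_row ?H)" by auto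
  from card_finite_spectrum(1)[OF this] show ?thesis
    by (simp add: singular_values_def spectrum_def)
qed

text \<open>For a nonsquare matrix both sides select the same smaller Gram matrix. In the square
  case the definition selects \<open>A\<^sup>* A\<close> for one and \<open>A A\<^sup>*\<close> for
  the other.\<close>

lemma singular_values_adjoint:
  "dim_row A \<noteq> dim_col A \<Longrightarrow> singular_values (mat_adjoint A) = singular_values A"
  by (auto simp: singular_values_def)

lemma mat_diag_mult_vec:
  fixes f :: "nat \<Rightarrow> 'a :: semiring_1"
  assumes "y \<in> carrier_vec n"
  shows "mat_diag n f *\<^sub>v y = Matrix.vec n (\<lambda>i. f i * y $ i)"
  by (rule eq_vecI) (use assms in \<open>auto simp: mat_diag_def scalar_prod_def if_distrib[of "\<lambda>z. z * _"] cong: if_cong\<close>)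

text \<open>In an orthonormal eigenbasis of \<open>A\<^sup>* A\<close> the squared norm of
  \<open>A x\<close> is a sum of squared coordinates weighted by eigenvalues, each at least the
  square of \<open>sigma_min A\<close>. Nonnegativity asks for \<open>0 < d\<close>, since otherwise
  \<open>Min\<close> is applied to the empty set.\<close>

lemma sigma_min_mult_le:
  assumes A: "A \<in> carrier_mat m d" and d: "d \<le> m" and x: "x \<in> carrier_vec d"
  shows "sigma_min A * vec_norm2 x \<le> vec_norm2 (A *\<^sub>v x)"
    and "0 < d \<Longrightarrow> sigma_min A \<ge> 0"
proof -
  define H where "H = mat_adjoint A * A"
  have H: "H \<in> carrier_mat d d" using A by (auto simp: H_def intro!: mult_carrier_mat)
  have hermH: "mat_adjoint H = H"
    using A by (simp add: H_def mat_adjoint_mult[of _ d m _ d])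
  obtain U l where U: "U \<in> carrier_mat d d" "mat_adjoint U * U = 1\<^sub>m d"
      and HU: "H = U * mat_diag d (\<lambda>i. complex_of_real (l i)) * mat_adjoint U"
    using hermitian_diagonalization[OF H hermH] by blast
  define U' where "U' = mat_adjoint U"
  have U': "U' \<in> carrier_mat d d" "mat_adjoint U' * U' = 1\<^sub>m d"
    using U unitary_other_side[OF U] by (simp_all add: U'_def)
  have norm_sq: "(vec_norm2 (A *\<^sub>v z))\<^sup>2 = (\<Sum>i<d. l i * (cmod ((U' *\<^sub>v z) $ i))\<^sup>2)"
    if z: "z \<in> carrier_vec d" for z
  proof -
    define y where "y = U' *\<^sub>v z"
    have y: "y \<in> carrier_vec d" using U' z by (simp add: y_def)
    let ?D = "mat_diag d (\<lambda>i. complex_of_real (l i))"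
    have D: "?D \<in> carrier_mat d d" by simp
    have "H *\<^sub>v z = U *\<^sub>v (?D *\<^sub>v y)"
      unfolding HU U'_def[symmetric] y_def
      using U(1) U'(1) D z by (simp add: assoc_mult_mat_vec[of _ d d _ d])
    moreover have "z \<bullet>c (U *\<^sub>v (?D *\<^sub>v y)) = y \<bullet>c (?D *\<^sub>v y)"
      using cscalar_prod_adjoint[OF U'(1) z, of "?D *\<^sub>v y"] mult_mat_vec_carrier[OF D y] by (simp add: U'_def y_def)
    moreover have "y \<bullet>c (?D *\<^sub>v y) = complex_of_real (\<Sum>i<d. l i * (cmod (y $ i))\<^sup>2)"
      using y unfolding mat_diag_mult_vec[OF y]
      by (auto simp: scalar_prod_def complex_norm_square[symmetric] atLeast0LessThan mult_ac intro!: sum.cong)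
    ultimately have "complex_of_real ((vec_norm2 (A *\<^sub>v z))\<^sup>2) = complex_of_real (\<Sum>i<d. l i * (cmod (y $ i))\<^sup>2)"
      using vec_norm2_mult_square[OF A z] by (simp only: H_def)
    then show ?thesis unfolding of_real_eq_iff y_def .
  qed
  have l: "l i \<ge> 0 \<and> sqrt (l i) \<in> singular_values A" if i: "i < d" for i
  proof
    \<comment> \<open>The column \<open>i\<close> of \<open>U\<close>, an eigenvector of
      \<open>H\<close> for \<open>l i\<close>.\<close>
    define u where "u = U *\<^sub>v unit_vec d i"
    have u: "u \<in> carrier_vec d" using U by (simp add: u_def)
    have U'u: "U' *\<^sub>v u = unit_vec d i"
      using assoc_mult_mat_vec[OF U'(1) U(1), of "unit_vec d i"] U(2) by (simp add: u_def U'_def)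
    \<comment> \<open>At \<open>u\<close> the weighted sum has the single term \<open>l i\<close>,
      which is thus a squared norm.\<close>
    have "(vec_norm2 (A *\<^sub>v u))\<^sup>2 = (\<Sum>j<d. if j = i then l i else 0)"
      unfolding norm_sq[OF u] U'u using i by (intro sum.cong) auto
    then have "(vec_norm2 (A *\<^sub>v u))\<^sup>2 = l i" using i by simp
    then show "l i \<ge> 0" by (metis zero_le_power2)
    let ?D = "mat_diag d (\<lambda>i. complex_of_real (l i))"
    have "H *\<^sub>v u = U *\<^sub>v (?D *\<^sub>v (U' *\<^sub>v u))"
      unfolding HU U'_def[symmetric]
      using U(1) U'(1) u by (simp add: assoc_mult_mat_vec[of _ d d _ d])
    also have "?D *\<^sub>v (U' *\<^sub>v u) = complex_of_real (l i) \<cdot>\<^sub>v unit_vec d i"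
      unfolding U'u using i by (auto simp: mat_diag_def)
    also have "U *\<^sub>v \<dots> = complex_of_real (l i) \<cdot>\<^sub>v u"
      unfolding u_def by (rule mult_mat_vec) (use U in auto)
    finally have "H *\<^sub>v u = complex_of_real (l i) \<cdot>\<^sub>v u" .
    moreover have "u \<noteq> 0\<^sub>v d"
    proof
      assume "u = 0\<^sub>v d"
      then have "unit_vec d i = (0\<^sub>v d :: complex vec)"
        using U'u[symmetric] U'(1) by (auto intro!: eq_vecI)
      then have "unit_vec d i $ i = (0\<^sub>v d :: complex vec) $ i" by (rule arg_cong)
      then show False using i by simp
    qed
    ultimately have "eigenvalue H (complex_of_real (l i))"
      using H u by (auto simp: eigenvalue_def eigenvector_def)
    then show "sqrt (l i) \<in> singular_values A"
      using A d by (auto simp: singular_values_def H_def image_iff intro!: exI[of _ "complex_of_real (l i)"])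
  qed
  have le: "sigma_min A \<le> sqrt (l i)" if "i < d" for i
    unfolding sigma_min_def using l[OF that] finite_singular_values by (auto intro: Min_le)
  show nonneg: "sigma_min A \<ge> 0" if "0 < d"
  proof -
    have "sigma_min A \<in> singular_values A"
      unfolding sigma_min_def using l[OF that] finite_singular_values by (intro Min_in) auto
    then obtain e where "sigma_min A = sqrt (Re e)" "eigenvalue H e"
      using A d by (auto simp: singular_values_def H_def)
    \<comment> \<open>The minimum is attained at some eigenvalue \<open>e\<close> of
      \<open>H\<close>; for its eigenvector \<open>v\<close>, \<open>\<parallel>A
      v\<parallel>\<^sup>2 = Re e * \<parallel>v\<parallel>\<^sup>2\<close>.\<close>
    moreover have "Re e \<ge> 0"
    proof -
      obtain v where v: "v \<in> carrier_vec d" "v \<noteq> 0\<^sub>v d" "H *\<^sub>v v = e \<cdot>\<^sub>v v"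
        using \<open>eigenvalue H e\<close> H by (auto simp: eigenvalue_def eigenvector_def)
      have "complex_of_real ((vec_norm2 (A *\<^sub>v v))\<^sup>2) = v \<bullet>c (e \<cdot>\<^sub>v v)"
        using vec_norm2_mult_square[OF A v(1)] v(3) by (simp only: H_def)
      also have "\<dots> = cnj e * complex_of_real ((vec_norm2 v)\<^sup>2)"
        using v(1) by (simp add: conjugate_smult_vec cscalar_prod_self)
      finally have "(vec_norm2 (A *\<^sub>v v))\<^sup>2 = Re e * (vec_norm2 v)\<^sup>2"
        by (simp add: complex_eq_iff)
      moreover have "(vec_norm2 v)\<^sup>2 > 0"
        using vec_norm2_eq_0[OF v(1)] v(2) by auto
      ultimately show ?thesis
        by (metis zero_le_power2 zero_le_mult_iff linorder_not_less)
    qed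
    ultimately show ?thesis by simp
  qed
  \<comment> \<open>Squaring \<open>sigma_min A \<le> sqrt (l i)\<close> relies on
    \<open>sigma_min A\<close> being nonnegative.\<close>
  have "(sigma_min A)\<^sup>2 \<le> l i" if "i < d" for i
    using le[OF that] nonneg that l[OF that] real_le_rsqrt by (metis gr_zeroI not_less0 power_mono real_sqrt_pow2)
  then have "(\<Sum>i<d. (sigma_min A)\<^sup>2 * (cmod ((U' *\<^sub>v x) $ i))\<^sup>2) \<le> (vec_norm2 (A *\<^sub>v x))\<^sup>2"
    unfolding norm_sq[OF x] by (intro sum_mono mult_right_mono) auto
  moreover have "(\<Sum>i<d. (cmod ((U' *\<^sub>v x) $ i))\<^sup>2) = (vec_norm2 x)\<^sup>2"
    using vec_norm2_isometry[OF U'(1) x U'(2)] vec_norm2_square[of "U' *\<^sub>v x"] U'(1) by simp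
  ultimately have "(sigma_min A * vec_norm2 x)\<^sup>2 \<le> (vec_norm2 (A *\<^sub>v x))\<^sup>2"
    by (simp add: power_mult_distrib flip: sum_distrib_left)
  then show "sigma_min A * vec_norm2 x \<le> vec_norm2 (A *\<^sub>v x)"
    by (rule power2_le_imp_le) simp
qed

text \<open>The right-hand side is taken in the range of \<open>A\<close>, so that
  \<open>y = pinv A r\<close> satisfies \<open>A y = r\<close>. A tall \<open>A\<close> is bounded
  below directly; for a wide one only \<open>A\<^sup>*\<close> is, which calls for a duality
  argument.\<close>

lemma pinv_norm_le:
  assumes A: "A \<in> carrier_mat m d" and x: "x \<in> carrier_vec d" and s: "sigma_min A \<noteq> 0"
  shows "vec_norm2 (pinv A *\<^sub>v (A *\<^sub>v x)) \<le> inverse (sigma_min A) * vec_norm2 (A *\<^sub>v x)"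
proof -
  define r where "r = A *\<^sub>v x"
  define y where "y = pinv A *\<^sub>v r"
  note X = pinv_carrier[OF A]
  have r: "r \<in> carrier_vec m" and y: "y \<in> carrier_vec d"
    using A X x by (auto simp: r_def y_def intro!: mult_mat_vec_carrier)
  have Ay: "A *\<^sub>v y = r"
    using mult_pinv_image[OF A x] by (simp add: y_def r_def)
  have "sigma_min A * vec_norm2 y \<le> vec_norm2 r \<and> sigma_min A > 0" if "0 < m" "0 < d"
  proof (cases "d \<le> m")
    case True
    then show ?thesis
      using sigma_min_mult_le[OF A True y] Ay s that by auto
  next
    case False
    define A' where "A' = mat_adjoint A"
    have A': "A' \<in> carrier_mat d m" using A by (simp add: A'_def)
    have sA': "sigma_min A' = sigma_min A"
      using False A by (simp add: sigma_min_def A'_def singular_values_adjoint)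
    have Xm: "pinv A * A * pinv A = pinv A" "mat_adjoint (pinv A * A) = pinv A * A"
      using is_moore_penrose_pinv[of A] by (auto simp: is_moore_penrose_def)
    \<comment> \<open>Chosen so that
      \<open>A\<^sup>* w = (pinv A * A)\<^sup>* y = pinv A * A * y = y\<close>, which puts
      \<open>y\<close> in the range of the tall matrix \<open>A\<^sup>*\<close>.\<close>
    define w where "w = mat_adjoint (pinv A) *\<^sub>v y"
    have w: "w \<in> carrier_vec m"
      using X y by (auto simp: w_def intro!: mult_mat_vec_carrier)
    have "A' *\<^sub>v w = (A' * mat_adjoint (pinv A)) *\<^sub>v y"
      unfolding w_def by (rule assoc_mult_mat_vec[symmetric]) (use A' X y in auto)
    also have "A' * mat_adjoint (pinv A) = pinv A * A"
      using mat_adjoint_mult[OF X A] Xm(2) by (simp add: A'_def)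
    also have "(pinv A * A) *\<^sub>v y = (pinv A * A * pinv A) *\<^sub>v r"
      unfolding y_def by (rule assoc_mult_mat_vec[symmetric]) (use A X r in auto)
    finally have yw: "A' *\<^sub>v w = y"
      by (simp add: Xm(1) y_def)
    have "complex_of_real ((vec_norm2 y)\<^sup>2) = y \<bullet>c (A' *\<^sub>v w)"
      by (simp add: yw cscalar_prod_self)
    also have "\<dots> = r \<bullet>c w"
      using cscalar_prod_adjoint[OF A y w] by (simp add: A'_def Ay)
    finally have "(vec_norm2 y)\<^sup>2 = cmod (r \<bullet>c w)"
      by (metis norm_of_real abs_of_nonneg zero_le_power2)
    also have "\<dots> \<le> vec_norm2 r * vec_norm2 w"
      by (rule cscalar_prod_le) (use r w in auto)
    finally have le: "(vec_norm2 y)\<^sup>2 \<le> vec_norm2 r * vec_norm2 w" .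
    have mA: "m \<le> d" using False by simp
    have sw: "sigma_min A * vec_norm2 w \<le> vec_norm2 y" and s0: "sigma_min A > 0"
      using sigma_min_mult_le[OF A' mA w] sA' yw s that by auto
    \<comment> \<open>Bound \<open>sigma_min A * \<parallel>w\<parallel>\<close> by
      \<open>\<parallel>A\<^sup>* w\<parallel> = \<parallel>y\<parallel>\<close> and cancel one
      factor \<open>\<parallel>y\<parallel>\<close>.\<close>
    have "sigma_min A * (vec_norm2 y)\<^sup>2 \<le> vec_norm2 r * (sigma_min A * vec_norm2 w)"
      using mult_left_mono[OF le, of "sigma_min A"] s0 by (simp add: mult_ac)
    also have "\<dots> \<le> vec_norm2 r * vec_norm2 y"
      by (rule mult_left_mono[OF sw]) simp
    finally have "sigma_min A * vec_norm2 y \<le> vec_norm2 r"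
      by (cases "vec_norm2 y = 0") (auto simp: power2_eq_square less_le)
    then show ?thesis using s0 by simp
  qed
  \<comment> \<open>An empty matrix has no singular values and \<open>sigma_min A\<close> is
    unspecified; the bound survives because both norms vanish.\<close>
  moreover have "vec_norm2 y = 0 \<and> vec_norm2 r = 0" if "m = 0 \<or> d = 0"
  proof -
    have "vec_norm2 r = 0"
      using that r x A by (auto simp: r_def vec_norm2_def scalar_prod_def)
    then have "r = 0\<^sub>v m" using vec_norm2_eq_0[OF r] by simp
    then have "y = 0\<^sub>v d" using X by (auto simp: y_def)
    then show ?thesis using \<open>vec_norm2 r = 0\<close> by simp
  qed
  ultimately have "vec_norm2 y \<le> inverse (sigma_min A) * vec_norm2 r"
    by (cases "m = 0 \<or> d = 0") (auto simp: field_simps)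
  then show ?thesis by (simp add: y_def r_def)
qed

section \<open>Vectorisation\<close>

text \<open>Division with remainder splits a stacked index into block and offset; applied twice, it
  resolves the three-level indices of a vectorised block row.\<close>

lemma sum_lessThan_mult:
  fixes f :: "nat \<Rightarrow> 'a :: comm_monoid_add"
  shows "(\<Sum>l<n * m. f l) = (\<Sum>j<n. \<Sum>i<m. f (j * m + i))"
proof -
  have "(\<Sum>i<m. f (j * m + i)) = sum f {j * m..<j * m + m}" for j
    using sum.shift_bounds_nat_ivl[of f 0 "j * m" m] by (simp add: atLeast0LessThan add.commute)
  then show ?thesis
    by (simp add: sum.nat_group)
qed

lemma index_block_less: "j < n \<Longrightarrow> i < m \<Longrightarrow> j * m + i < n * (m :: nat)"
  using mult_le_mono1[of "Suc j" n m] by simp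

lemma vectorize_carrier: "A \<in> carrier_mat m n \<Longrightarrow> vectorize A \<in> carrier_vec (n * m)"
  by (rule carrier_vecI) (simp add: vectorize_def mult.commute)

lemma vectorize_index:
  assumes "A \<in> carrier_mat m n" "i < m" "j < n"
  shows "vectorize A $ (j * m + i) = A $$ (i, j)"
  using assms index_block_less[of j n i m] by (simp add: vectorize_def mult.commute)

lemma vectorize_add:
  assumes "A \<in> carrier_mat m n" "B \<in> carrier_mat m n"
  shows "vectorize (A + B) = vectorize A + vectorize B"
proof (rule eq_vecI)
  fix l assume "l < dim_vec (vectorize A + vectorize B)"
  then have l: "l < m * n" using assms by (simp add: vectorize_def)
  \<comment> \<open>The bound on \<open>l\<close> also forces \<open>m > 0\<close>, which the
    estimate for \<open>mod\<close> requires.\<close>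
  then have "l mod m < m" "l div m < n"
    by (auto simp: less_mult_imp_div_less mult.commute intro!: mod_less_divisor Nat.gr0I)
  then show "vectorize (A + B) $ l = (vectorize A + vectorize B) $ l"
    using assms l by (simp add: vectorize_def)
qed (use assms in \<open>simp add: vectorize_def\<close>)

lemma vectorize_eq_iff:
  assumes "A \<in> carrier_mat m n" "B \<in> carrier_mat m n"
  shows "vectorize A = vectorize B \<longleftrightarrow> A = B"
proof
  assume eq: "vectorize A = vectorize B"
  show "A = B"
  proof (rule eq_matI)
    fix i j assume "i < dim_row B" "j < dim_col B"
    then show "A $$ (i, j) = B $$ (i, j)"
      using assms vectorize_index[OF assms(1), of i j] vectorize_index[OF assms(2), of i j] eq by simp
  qed (use assms in auto)
qed simp

lemma vectorize_zero: "vectorize (0\<^sub>m m n) = 0\<^sub>v (n * m)"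
proof (rule eq_vecI)
  fix l assume "l < dim_vec (0\<^sub>v (n * m) :: complex vec)"
  then have l: "l < m * n" by (simp add: mult.commute)
  then have "l mod m < m" "l div m < n"
    by (auto simp: less_mult_imp_div_less mult.commute intro!: mod_less_divisor Nat.gr0I)
  then show "vectorize (0\<^sub>m m n) $ l = 0\<^sub>v (n * m) $ l"
    using l by (simp add: vectorize_def mult.commute)
qed (simp add: vectorize_def mult.commute)

lemma vec_eq_blockwiseI:
  assumes "v \<in> carrier_vec (n * m)" "w \<in> carrier_vec (n * m)"
    and "\<And>j i. j < n \<Longrightarrow> i < m \<Longrightarrow> v $ (j * m + i) = w $ (j * m + i)"
  shows "v = w"
proof (rule eq_vecI)
  fix l assume "l < dim_vec w"
  then have "l < n * m" using assms(2) by simp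
  then have "l mod m < m" "l div m < n"
    by (auto simp: less_mult_imp_div_less intro!: mod_less_divisor Nat.gr0I)
  then show "v $ l = w $ l" using assms(3)[of "l div m" "l mod m"] by simp
qed (use assms in auto)

lemma frob_norm_vectorize: "frob_norm A = vec_norm2 (vectorize A)"
proof -
  define m n where "m = dim_row A" and "n = dim_col A"
  have A: "A \<in> carrier_mat m n" by (simp add: m_def n_def)
  have "(\<Sum>l<dim_vec (vectorize A). (cmod (vectorize A $ l))\<^sup>2)
      = (\<Sum>j<n. \<Sum>i<m. (cmod (vectorize A $ (j * m + i)))\<^sup>2)"
    using vectorize_carrier[OF A] by (simp add: sum_lessThan_mult)
  also have "\<dots> = (\<Sum>j<n. \<Sum>i<m. (cmod (A $$ (i, j)))\<^sup>2)"
    by (intro sum.cong refl) (simp add: vectorize_index[OF A])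
  also have "\<dots> = (\<Sum>i<m. \<Sum>j<n. (cmod (A $$ (i, j)))\<^sup>2)"
    by (rule sum.swap)
  finally show ?thesis
    by (simp add: frob_norm_def vec_norm2_def m_def n_def)
qed

lemma frob_inner_vectorize:
  assumes A: "A \<in> carrier_mat m n" and B: "B \<in> carrier_mat m n"
  shows "frob_inner A B = vectorize A \<bullet>c vectorize B"
proof -
  have "vectorize A \<bullet>c vectorize B = (\<Sum>l<n * m. vectorize A $ l * cnj (vectorize B $ l))"
    using vectorize_carrier[OF A] vectorize_carrier[OF B] by (simp add: scalar_prod_def atLeast0LessThan)
  also have "\<dots> = (\<Sum>j<n. \<Sum>i<m. A $$ (i, j) * cnj (B $$ (i, j)))"
    unfolding sum_lessThan_mult
    by (intro sum.cong refl) (simp add: vectorize_index[OF A] vectorize_index[OF B])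
  also have "\<dots> = (\<Sum>i<m. \<Sum>j<n. A $$ (i, j) * cnj (B $$ (i, j)))"
    by (rule sum.swap)
  finally show ?thesis
    using A by (simp add: frob_inner_def)
qed

section \<open>The residual map\<close>

text \<open>The carrier \<open>S\<close> is kept general so that one lemma covers sums in the full
  matrix space, as in \<open>residual\<close>, and linear combinations inside a subspace.\<close>

lemma finsum_mat_index:
  fixes S :: "complex mat set"
  assumes "abelian_monoid (module_mat TYPE(complex) n p\<lparr>carrier := S\<rparr>)" "S \<subseteq> carrier_mat n p"
    and "finite I" "g \<in> I \<rightarrow> S" "a < n" "b < p"
  shows "finsum (module_mat TYPE(complex) n p\<lparr>carrier := S\<rparr>) g I $$ (a, b) = (\<Sum>i\<in>I. g i $$ (a, b))"
proof -
  interpret abelian_monoid "module_mat TYPE(complex) n p\<lparr>carrier := S\<rparr>" by fact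
  show ?thesis
    using assms(3,4)
  proof (induction I rule: finite_induct)
    case empty
    then show ?case using assms(5,6) by (simp add: finsum_empty module_mat_simps)
  next
    case (insert i I)
    have closed: "finsum (module_mat TYPE(complex) n p\<lparr>carrier := S\<rparr>) g I \<in> carrier_mat n p"
      using finsum_closed[of g I] insert.prems assms(2) by auto
    show ?case
      using insert closed assms(5,6) by (subst finsum_insert) (auto simp: module_mat_simps)
  qed
qed

lemma residual_term_carrier:
  "A \<in> carrier_mat n n \<Longrightarrow> V \<in> carrier_mat n p \<Longrightarrow> A * V * mat_diag p g \<in> carrier_mat n p"
  by (intro mult_carrier_mat[of _ n p] mult_carrier_mat[of _ n n]) auto

lemma residual_carrier:
  assumes "V \<in> carrier_mat n p" "\<And>j. j < k \<Longrightarrow> A j \<in> carrier_mat n n"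
  shows "residual n p k f V lam A \<in> carrier_mat n p"
proof -
  interpret abelian_group "module_mat TYPE(complex) n p" by (rule abelian_group_mat)
  have "residual n p k f V lam A \<in> carrier (module_mat TYPE(complex) n p)"
    unfolding residual_def
    by (rule finsum_closed) (simp add: module_mat_simps residual_term_carrier[OF assms(2,1)])
  then show ?thesis by (simp add: module_mat_simps)
qed

lemma residual_index:
  assumes V: "V \<in> carrier_mat n p" and A: "\<And>j. j < k \<Longrightarrow> A j \<in> carrier_mat n n" and ab: "a < n" "b < p"
  shows "residual n p k f V lam A $$ (a, b) = (\<Sum>j<k. \<Sum>c<n. A j $$ (a, c) * V $$ (c, b) * f j (lam b))"
proof -
  interpret abelian_group "module_mat TYPE(complex) n p" by (rule abelian_group_mat)
  \<comment> \<open>Presents the full space in the form with an explicit carrier that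
    \<open>finsum_mat_index\<close> expects.\<close>
  have eq: "module_mat TYPE(complex) n p\<lparr>carrier := carrier_mat n p\<rparr> = module_mat TYPE(complex) n p"
    by (simp add: module_mat_def)
  have "residual n p k f V lam A $$ (a, b) = (\<Sum>j<k. (A j * V * mat_diag p (\<lambda>i. f j (lam i))) $$ (a, b))"
    unfolding residual_def
    using finsum_mat_index[where S = "carrier_mat n p" and I = "{..<k}" and n = n and p = p] eq abelian_monoid_axioms
      residual_term_carrier[OF A V] ab by auto
  also have "\<dots> = (\<Sum>j<k. \<Sum>c<n. A j $$ (a, c) * V $$ (c, b) * f j (lam b))"
  proof (rule sum.cong[OF refl])
    fix j assume "j \<in> {..<k}"
    then have Aj: "A j \<in> carrier_mat n n" using A by simp
    then have "A j * V \<in> carrier_mat n p" using V by simp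
    from mat_diag_mult_right[OF this, of "\<lambda>i. f j (lam i)"]
    show "(A j * V * mat_diag p (\<lambda>i. f j (lam i))) $$ (a, b) = (\<Sum>c<n. A j $$ (a, c) * V $$ (c, b) * f j (lam b))"
      using Aj V ab by (simp add: scalar_prod_def sum_distrib_right atLeast0LessThan)
  qed
  finally show ?thesis .
qed

lemma residual_add:
  assumes "V \<in> carrier_mat n p" "\<And>j. j < k \<Longrightarrow> A j \<in> carrier_mat n n" "\<And>j. j < k \<Longrightarrow> B j \<in> carrier_mat n n"
  shows "residual n p k f V lam (\<lambda>j. A j + B j) = residual n p k f V lam A + residual n p k f V lam B"
proof -
  have AB: "\<And>j. j < k \<Longrightarrow> A j + B j \<in> carrier_mat n n"
    using assms by simp
  note c = residual_carrier[OF assms(1)]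
  show ?thesis
  proof (rule eq_matI)
    fix a b
    assume "a < dim_row (residual n p k f V lam A + residual n p k f V lam B)"
      and "b < dim_col (residual n p k f V lam A + residual n p k f V lam B)"
    then have ab: "a < n" "b < p"
      using c[of k B f lam] assms(3) by auto
    have "(\<Sum>c<n. (A j + B j) $$ (a, c) * V $$ (c, b) * f j (lam b))
       = (\<Sum>c<n. A j $$ (a, c) * V $$ (c, b) * f j (lam b)) + (\<Sum>c<n. B j $$ (a, c) * V $$ (c, b) * f j (lam b))"
      if "j < k" for j
      using assms(2,3)[OF that] ab by (simp add: distrib_right sum.distrib)
    then show "residual n p k f V lam (\<lambda>j. A j + B j) $$ (a, b)
        = (residual n p k f V lam A + residual n p k f V lam B) $$ (a, b)"
      using c[of k A f lam] c[of k B f lam] assms ab AB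
      by (simp add: residual_index sum.distrib)
  qed (use c[of k B f lam] c[of k "\<lambda>j. A j + B j" f lam] assms(3) AB in auto)
qed

lemma block_row_carrier: "block_row n k A \<in> carrier_mat n (k * n)"
  by (simp add: block_row_def)

lemma block_row_index:
  "a < n \<Longrightarrow> j < k \<Longrightarrow> b < n \<Longrightarrow> block_row n k A $$ (a, j * n + b) = A j $$ (a, b)"
  using index_block_less[of j k b n] by (simp add: block_row_def)

text \<open>Since \<open>V\<close> and the scalars \<open>f\<^sub>j(\<lambda>\<^sub>i)\<close> act from the
  right, \<open>vec\<close> turns them into the left Kronecker factor.\<close>

lemma kronecker_khatri_rao_vectorize:
  assumes V: "V \<in> carrier_mat n p" and A: "\<And>j. j < k \<Longrightarrow> A j \<in> carrier_mat n n"
    and G: "G = Matrix.mat p k (\<lambda>(i, j). f j (lam i))"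
  shows "kronecker (khatri_rao_T G (transpose_mat V)) (1\<^sub>m n) *\<^sub>v vectorize (block_row n k A)
    = vectorize (residual n p k f V lam A)"
    (is "?K *\<^sub>v ?z = _")
proof (rule vec_eq_blockwiseI[of _ p n])
  have dims: "dim_row (khatri_rao_T G (transpose_mat V)) = p" "dim_col (khatri_rao_T G (transpose_mat V)) = k * n"
    using V by (simp_all add: khatri_rao_T_def G)
  have K: "?K \<in> carrier_mat (p * n) (k * n * n)"
    by (simp add: kronecker_def dims)
  have z: "?z \<in> carrier_vec (k * n * n)"
    by (rule vectorize_carrier[OF block_row_carrier])
  show "?K *\<^sub>v ?z \<in> carrier_vec (p * n)" using K z by simp
  show "vectorize (residual n p k f V lam A) \<in> carrier_vec (p * n)"
    by (rule vectorize_carrier[OF residual_carrier[OF V A]])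
  fix i a assume i: "i < p" and a: "a < n"
  \<comment> \<open>Row \<open>i * n + a\<close> is entry \<open>a\<close> of residual column
    \<open>i\<close>; column \<open>(j * n + b) * n + c\<close> is entry \<open>c\<close> of column
    \<open>b\<close> of block \<open>j\<close>. The identity factor leaves only
    \<open>a = c\<close>.\<close>
  have Kentry: "?K $$ (i * n + a, (j * n + b) * n + c) = (if a = c then f j (lam i) * V $$ (b, i) else 0)"
    if "j < k" "b < n" "c < n" for j b c
  proof -
    have *: "i * n + a < p * n" "(j * n + b) * n + c < k * n * n" "j * n + b < k * n"
      using index_block_less i a that by auto
    show ?thesis
      using * i a that V by (simp add: kronecker_def dims) (simp add: khatri_rao_T_def G)
  qed
  have zentry: "?z $ ((j * n + b) * n + c) = A j $$ (c, b)" if "j < k" "b < n" "c < n" for j b c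
    using that index_block_less[of j k b n] vectorize_index[OF block_row_carrier[of n k A], of c "j * n + b"]
    by (simp add: block_row_index)
  have "(?K *\<^sub>v ?z) $ (i * n + a) = (\<Sum>q<k * n * n. ?K $$ (i * n + a, q) * ?z $ q)"
    using K z index_block_less[OF i a] by (simp add: scalar_prod_def atLeast0LessThan)
  also have "\<dots> = (\<Sum>j<k. \<Sum>b<n. \<Sum>c<n. ?K $$ (i * n + a, (j * n + b) * n + c) * ?z $ ((j * n + b) * n + c))"
    by (simp only: sum_lessThan_mult)
  also have "\<dots> = (\<Sum>j<k. \<Sum>b<n. \<Sum>c<n. if a = c then f j (lam i) * V $$ (b, i) * A j $$ (a, b) else 0)"
    by (intro sum.cong refl) (simp add: Kentry zentry)
  also have "\<dots> = residual n p k f V lam A $$ (a, i)"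
    using a i by (simp add: residual_index[OF V A] mult_ac)
  also have "\<dots> = vectorize (residual n p k f V lam A) $ (i * n + a)"
    by (rule vectorize_index[symmetric]) (use residual_carrier[OF V A] a i in auto)
  finally show "(?K *\<^sub>v ?z) $ (i * n + a) = vectorize (residual n p k f V lam A) $ (i * n + a)" .
qed

section \<open>Orthonormal bases and block diagonal matrices\<close>

lemma subspace_matD:
  assumes "VectorSpace.subspace class_ring S (module_mat TYPE(complex) n m)"
  shows "S \<subseteq> carrier_mat n m" "0\<^sub>m n m \<in> S"
    and "\<And>X Y. X \<in> S \<Longrightarrow> Y \<in> S \<Longrightarrow> X + Y \<in> S"
    and "\<And>c X. X \<in> S \<Longrightarrow> c \<cdot>\<^sub>m X \<in> S"
    and "vectorspace class_ring (module_mat TYPE(complex) n m\<lparr>carrier := S\<rparr>)"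
proof -
  interpret vectorspace class_ring "module_mat TYPE(complex) n m" by (rule matrix_vs)
  interpret submodule class_ring S "module_mat TYPE(complex) n m"
    using assms by (simp add: VectorSpace.subspace_def)
  show "S \<subseteq> carrier_mat n m" "0\<^sub>m n m \<in> S"
    and "\<And>X Y. X \<in> S \<Longrightarrow> Y \<in> S \<Longrightarrow> X + Y \<in> S"
    and "\<And>c X. X \<in> S \<Longrightarrow> c \<cdot>\<^sub>m X \<in> S"
    using subset zero_closed m_closed smult_closed by (auto simp: module_mat_simps)
  show "vectorspace class_ring (module_mat TYPE(complex) n m\<lparr>carrier := S\<rparr>)"
    by (rule subspace_is_vs[OF assms])
qed

lemma orthonormal_basis_subset:
  assumes "VectorSpace.subspace class_ring S (module_mat TYPE(complex) n n)" "orthonormal_basis n S Bs"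
  shows "set Bs \<subseteq> S"
  using assms(2) vectorspace.basis_def[OF subspace_matD(5)[OF assms(1)]]
  by (auto simp: orthonormal_basis_def)

text \<open>A matrix at two positions would have inner product both 0 and 1 with itself.\<close>

lemma orthonormal_basis_distinct:
  assumes "orthonormal_basis n S Bs"
  shows "distinct Bs"
  using assms unfolding orthonormal_basis_def distinct_conv_nth by (metis zero_neq_one)

lemma basis_mat_carrier: "basis_mat n Bs \<in> carrier_mat (n * n) (length Bs)"
  by (rule carrier_matI) (simp_all add: basis_mat_def)

text \<open>The Gram matrix of the vectorised basis consists of the Frobenius inner products of its
  members.\<close>

lemma basis_mat_isometry:
  assumes "VectorSpace.subspace class_ring S (module_mat TYPE(complex) n n)" "orthonormal_basis n S Bs"
  shows "mat_adjoint (basis_mat n Bs) * basis_mat n Bs = 1\<^sub>m (length Bs)"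
proof (rule eq_matI)
  fix a b assume "a < dim_row (1\<^sub>m (length Bs) :: complex mat)" "b < dim_col (1\<^sub>m (length Bs) :: complex mat)"
  then have ab: "a < length Bs" "b < length Bs" by auto
  have car: "Bs ! c \<in> carrier_mat n n" if "c < length Bs" for c
    using orthonormal_basis_subset[OF assms] subspace_matD(1)[OF assms(1)] that by (meson nth_mem subset_iff)
  have col: "col (basis_mat n Bs) c = vectorize (Bs ! c)" if "c < length Bs" for c
    using that vectorize_carrier[OF car[OF that]] by (simp add: basis_mat_def)
  have "(mat_adjoint (basis_mat n Bs) * basis_mat n Bs) $$ (a, b)
      = conjugate (col (basis_mat n Bs) a) \<bullet> col (basis_mat n Bs) b"
    using ab basis_mat_carrier[of n Bs] by (auto simp: scalar_prod_def intro!: sum.cong)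
  also have "\<dots> = vectorize (Bs ! b) \<bullet>c vectorize (Bs ! a)"
    unfolding col[OF ab(1)] col[OF ab(2)]
    by (rule conjugate_vec_sprod_comm[of _ "n * n", symmetric]) (use ab car vectorize_carrier in auto)
  also have "\<dots> = frob_inner (Bs ! b) (Bs ! a)"
    by (rule frob_inner_vectorize[symmetric, OF car[OF ab(2)] car[OF ab(1)]])
  also have "\<dots> = 1\<^sub>m (length Bs) $$ (a, b)"
    using assms(2) ab by (auto simp: orthonormal_basis_def)
  finally show "(mat_adjoint (basis_mat n Bs) * basis_mat n Bs) $$ (a, b) = 1\<^sub>m (length Bs) $$ (a, b)" .
qed (use basis_mat_carrier[of n Bs] in auto)

lemma basis_mat_mult_vec:
  assumes B: "\<And>a. a < length Bs \<Longrightarrow> Bs ! a \<in> carrier_mat n n" and x: "x \<in> carrier_vec (length Bs)"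
  shows "basis_mat n Bs *\<^sub>v x = vectorize (Matrix.mat n n (\<lambda>(i, j). \<Sum>a<length Bs. x $ a * (Bs ! a) $$ (i, j)))"
    (is "_ = vectorize ?Y")
proof (rule vec_eq_blockwiseI[of _ n n])
  have Y: "?Y \<in> carrier_mat n n" by simp
  show "basis_mat n Bs *\<^sub>v x \<in> carrier_vec (n * n)"
    using basis_mat_carrier[of n Bs] x by simp
  show "vectorize ?Y \<in> carrier_vec (n * n)" using vectorize_carrier[OF Y] .
  fix j i assume j: "j < n" and i: "i < n"
  have "(basis_mat n Bs *\<^sub>v x) $ (j * n + i) = (\<Sum>a<length Bs. vectorize (Bs ! a) $ (j * n + i) * x $ a)"
    using x index_block_less[OF j i]
    by (simp add: basis_mat_def scalar_prod_def atLeast0LessThan mat_of_cols_index)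
  also have "\<dots> = (\<Sum>a<length Bs. x $ a * (Bs ! a) $$ (i, j))"
    by (intro sum.cong refl) (simp add: vectorize_index[OF B i j])
  also have "\<dots> = vectorize ?Y $ (j * n + i)"
    using i j by (simp add: vectorize_index[OF Y])
  finally show "(basis_mat n Bs *\<^sub>v x) $ (j * n + i) = vectorize ?Y $ (j * n + i)" .
qed

text \<open>The columns are the vectorised basis members: closure of \<open>S\<close> under linear
  combinations gives one direction, spanning gives the other.\<close>

lemma basis_mat_range:
  assumes S: "VectorSpace.subspace class_ring S (module_mat TYPE(complex) n n)" and ob: "orthonormal_basis n S Bs"
  shows "(\<exists>x\<in>carrier_vec (length Bs). basis_mat n Bs *\<^sub>v x = y) \<longleftrightarrow> y \<in> vectorize ` S"
proof -
  note sub = orthonormal_basis_subset[OF S ob]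
  have BS: "Bs ! a \<in> S" if "a < length Bs" for a
    using sub that by auto
  have car: "Bs ! a \<in> carrier_mat n n" if "a < length Bs" for a
    using BS[OF that] subspace_matD(1)[OF S] by auto
  \<comment> \<open>Stated for all initial segments of the list so that induction adds one basis
    member at a time.\<close>
  have mem: "Matrix.mat n n (\<lambda>(i, j). \<Sum>a<m. x $ a * (Bs ! a) $$ (i, j)) \<in> S" if "m \<le> length Bs" for x m
    using that
  proof (induction m)
    case 0
    have "Matrix.mat n n (\<lambda>(i, j). \<Sum>a<0. x $ a * (Bs ! a) $$ (i, j)) = 0\<^sub>m n n" by (rule eq_matI) auto
    then show ?case using subspace_matD(2)[OF S] by (simp only:)
  next
    case (Suc m)
    have "Matrix.mat n n (\<lambda>(i, j). \<Sum>a<Suc m. x $ a * (Bs ! a) $$ (i, j))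
        = Matrix.mat n n (\<lambda>(i, j). \<Sum>a<m. x $ a * (Bs ! a) $$ (i, j)) + x $ m \<cdot>\<^sub>m (Bs ! m)"
      by (rule eq_matI) (use car[of m] Suc.prems in auto)
    also have "\<dots> \<in> S"
      by (intro subspace_matD(3,4)[OF S] Suc.IH BS) (use Suc.prems in auto)
    finally show ?case .
  qed
  show ?thesis
  proof
    assume "\<exists>x\<in>carrier_vec (length Bs). basis_mat n Bs *\<^sub>v x = y"
    then show "y \<in> vectorize ` S"
      using basis_mat_mult_vec[OF car] mem by blast
  next
    assume "y \<in> vectorize ` S"
    then obtain X where X: "X \<in> S" "y = vectorize X" by auto
    interpret W: vectorspace class_ring "module_mat TYPE(complex) n n\<lparr>carrier := S\<rparr>"
      by (rule subspace_matD(5)[OF S])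
    have "X \<in> W.span (set Bs)"
      using ob X(1) by (simp add: orthonormal_basis_def W.basis_def)
    then obtain c where c: "W.lincomb c (set Bs) = X"
      using W.finite_in_span[of "set Bs" X] sub by auto
    have summands: "(\<lambda>B. c B \<cdot>\<^sub>m B) \<in> set Bs \<rightarrow> S"
      using sub subspace_matD(4)[OF S] by blast
    have "X $$ (i, j) = (\<Sum>a<length Bs. c (Bs ! a) * (Bs ! a) $$ (i, j))" if "i < n" "j < n" for i j
    proof -
      have "X $$ (i, j) = (\<Sum>B\<in>set Bs. (c B \<cdot>\<^sub>m B) $$ (i, j))"
        unfolding c[symmetric] W.lincomb_def
        using finsum_mat_index[OF W.abelian_monoid_axioms subspace_matD(1)[OF S], of "set Bs", OF _ summands that]
        by (simp add: module_mat_simps)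
      also have "\<dots> = (\<Sum>B\<in>set Bs. c B * B $$ (i, j))"
        using that sub subspace_matD(1)[OF S] by (intro sum.cong refl) auto
      \<comment> \<open>The coefficients are indexed by matrices; distinctness lets the sum over the
        set run over list positions instead.\<close>
      also have "\<dots> = (\<Sum>a<length Bs. c (Bs ! a) * (Bs ! a) $$ (i, j))"
        by (rule sum.reindex_bij_betw[symmetric, OF bij_betw_nth[OF orthonormal_basis_distinct[OF ob]]]) auto
      finally show ?thesis .
    qed
    then have "X = Matrix.mat n n (\<lambda>(i, j). \<Sum>a<length Bs. Matrix.vec (length Bs) (\<lambda>a. c (Bs ! a)) $ a * (Bs ! a) $$ (i, j))"
      using subspace_matD(1)[OF S] X(1) by (intro eq_matI) auto
    then show "\<exists>x\<in>carrier_vec (length Bs). basis_mat n Bs *\<^sub>v x = y"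
      using basis_mat_mult_vec[OF car, of "Matrix.vec (length Bs) (\<lambda>a. c (Bs ! a))"] X(2)
      by (intro bexI[of _ "Matrix.vec (length Bs) (\<lambda>a. c (Bs ! a))"]) auto
  qed
qed

section \<open>Block diagonal matrices: isometry and range\<close>

lemma diag_block_mat_isometry:
  fixes As :: "complex mat list"
  assumes "\<And>A. A \<in> set As \<Longrightarrow> mat_adjoint A * A = 1\<^sub>m (dim_col A)"
  shows "mat_adjoint (diag_block_mat As) * diag_block_mat As = 1\<^sub>m (dim_col (diag_block_mat As))"
  using assms
proof (induction As)
  case Nil
  show ?case by (rule eq_matI) auto
next
  case (Cons A As)
  define D where "D = diag_block_mat As"
  have A: "A \<in> carrier_mat (dim_row A) (dim_col A)" and D: "D \<in> carrier_mat (dim_row D) (dim_col D)"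
    by auto
  have "mat_adjoint A * A = 1\<^sub>m (dim_col A)" "mat_adjoint D * D = 1\<^sub>m (dim_col D)"
    using Cons by (auto simp: D_def)
  then show ?case
    unfolding diag_block_mat.simps D_def[symmetric] Let_def mat_adjoint_four_block_diag[OF A D]
    by (subst mult_four_block_diag) (auto intro: A D)
qed

lemma four_block_diag_mult_vec:
  fixes A D :: "'a :: comm_ring_1 mat"
  assumes A: "A \<in> carrier_mat a b" and D: "D \<in> carrier_mat c d"
    and x: "x \<in> carrier_vec b" and y: "y \<in> carrier_vec d"
  shows "four_block_mat A (0\<^sub>m a d) (0\<^sub>m c b) D *\<^sub>v (x @\<^sub>v y) = (A *\<^sub>v x) @\<^sub>v (D *\<^sub>v y)"
  by (subst four_block_mat_mult_vec[OF A _ _ D x y]) (use assms in auto)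

text \<open>The blocks act on separate pieces of \<open>x\<close> and fill consecutive segments of
  \<open>y\<close>, so each segment can be solved for on its own. Blocks share the row count
  \<open>N\<close> but may differ in width.\<close>

lemma diag_block_mat_range:
  fixes As :: "'a :: comm_ring_1 mat list"
  assumes "\<And>A. A \<in> set As \<Longrightarrow> dim_row A = N" "y \<in> carrier_vec (length As * N)"
  shows "(\<exists>x\<in>carrier_vec (dim_col (diag_block_mat As)). diag_block_mat As *\<^sub>v x = y)
    \<longleftrightarrow> (\<forall>j<length As. \<exists>x\<in>carrier_vec (dim_col (As ! j)). As ! j *\<^sub>v x = Matrix.vec N (\<lambda>i. y $ (j * N + i)))"
  using assms
proof (induction As arbitrary: y)
  case Nil
  then show ?case by (intro iffI bexI[of _ "0\<^sub>v 0"]) auto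
next
  case (Cons A As)
  define D where "D = diag_block_mat As"
  define y1 where "y1 = Matrix.vec N (\<lambda>i. y $ i)"
  define y2 where "y2 = Matrix.vec (length As * N) (\<lambda>i. y $ (N + i))"
  have A: "A \<in> carrier_mat N (dim_col A)" using Cons.prems(1) by (intro carrier_matI) simp_all
  have "sum_list (map dim_row As) = length As * N"
    using Cons.prems(1) by (induction As) auto
  then have D: "D \<in> carrier_mat (length As * N) (dim_col D)"
    by (intro carrier_matI) (simp_all add: D_def dim_diag_block_mat)
  have y: "y = y1 @\<^sub>v y2"
    using Cons.prems(2) by (intro eq_vecI) (auto simp: y1_def y2_def)
  have P: "diag_block_mat (A # As) = four_block_mat A (0\<^sub>m N (dim_col D)) (0\<^sub>m (length As * N) (dim_col A)) D"
    using carrier_matD(1)[OF A] carrier_matD(1)[OF D] by (simp add: D_def Let_def)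
  have dimP: "dim_col (diag_block_mat (A # As)) = dim_col A + dim_col D"
    by (simp add: D_def Let_def)
  have mult: "diag_block_mat (A # As) *\<^sub>v (a @\<^sub>v d) = (A *\<^sub>v a) @\<^sub>v (D *\<^sub>v d)"
    if "a \<in> carrier_vec (dim_col A)" "d \<in> carrier_vec (dim_col D)" for a d
    unfolding P by (rule four_block_diag_mult_vec[OF A D that])
  have "(\<exists>x\<in>carrier_vec (dim_col (diag_block_mat (A # As))). diag_block_mat (A # As) *\<^sub>v x = y)
      \<longleftrightarrow> (\<exists>a\<in>carrier_vec (dim_col A). A *\<^sub>v a = y1) \<and> (\<exists>d\<in>carrier_vec (dim_col D). D *\<^sub>v d = y2)"
    (is "?L \<longleftrightarrow> ?R")
  proof
    assume ?L
    then obtain x where x: "x \<in> carrier_vec (dim_col A + dim_col D)" "diag_block_mat (A # As) *\<^sub>v x = y"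
      unfolding dimP by blast
    \<comment> \<open>Cut \<open>x\<close> at the width of the first block.\<close>
    define a d where "a = vec_first x (dim_col A)" and "d = vec_last x (dim_col D)"
    have ad: "a \<in> carrier_vec (dim_col A)" "d \<in> carrier_vec (dim_col D)" "x = a @\<^sub>v d"
      using vec_first_last_append[OF x(1)] by (auto simp: a_def d_def)
    have "(A *\<^sub>v a) @\<^sub>v (D *\<^sub>v d) = y1 @\<^sub>v y2"
      using mult[OF ad(1,2)] x(2) by (simp add: ad(3) y)
    then have "A *\<^sub>v a = y1 \<and> D *\<^sub>v d = y2"
      using append_vec_eq[OF mult_mat_vec_carrier[OF A ad(1)], of y1] by (simp add: y1_def)
    then show ?R using ad by auto
  next
    assume ?R
    then obtain a d where ad: "a \<in> carrier_vec (dim_col A)" "d \<in> carrier_vec (dim_col D)"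
      "A *\<^sub>v a = y1" "D *\<^sub>v d = y2" by auto
    then show ?L
      unfolding dimP using mult[OF ad(1,2)] y by (intro bexI[of _ "a @\<^sub>v d"]) (simp_all del: diag_block_mat.simps)
  qed
  also have "(\<exists>d\<in>carrier_vec (dim_col D). D *\<^sub>v d = y2) \<longleftrightarrow>
     (\<forall>j<length As. \<exists>x\<in>carrier_vec (dim_col (As ! j)). As ! j *\<^sub>v x = Matrix.vec N (\<lambda>i. y2 $ (j * N + i)))"
    unfolding D_def by (rule Cons.IH) (use Cons.prems(1) in \<open>auto simp: y2_def\<close>)
  \<comment> \<open>Dropping the first segment shifts segment \<open>j\<close> of \<open>y2\<close>
    to segment \<open>Suc j\<close> of \<open>y\<close>.\<close>
  also have "\<dots> \<longleftrightarrow> (\<forall>j<length As. \<exists>x\<in>carrier_vec (dim_col (As ! j)).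
      As ! j *\<^sub>v x = Matrix.vec N (\<lambda>i. y $ (Suc j * N + i)))"
  proof -
    have "Matrix.vec N (\<lambda>i. y2 $ (j * N + i)) = Matrix.vec N (\<lambda>i. y $ (Suc j * N + i))" if "j < length As" for j
      using index_block_less[OF that] by (intro eq_vecI) (auto simp: y2_def add.assoc)
    then show ?thesis by auto
  qed
  finally show ?case
    by (simp add: All_less_Suc2 y1_def)
qed

section \<open>The structured backward error\<close>

lemma uminus_mult_mat_vec_right:
  fixes A :: "'a :: comm_ring_1 mat"
  assumes "A \<in> carrier_mat m d" "x \<in> carrier_vec d"
  shows "A *\<^sub>v (- x) = - (A *\<^sub>v x)"
  by (rule eq_vecI) (use assms in auto)

text \<open>Column stacking of a block row concatenates the vectorised blocks, and the range of
  \<open>P\<close> consists of the concatenations of elements of the vectorised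
  \<open>S j\<close>.\<close>

lemma block_basis_range:
  assumes S: "\<And>j. j < k \<Longrightarrow> VectorSpace.subspace class_ring (S j) (module_mat TYPE(complex) n n)"
    and B: "\<And>j. j < k \<Longrightarrow> orthonormal_basis n (S j) (B j)"
    and P: "P = diag_block_mat (map (\<lambda>j. basis_mat n (B j)) [0..<k])"
  shows "{P *\<^sub>v x | x. x \<in> carrier_vec (dim_col P)}
    = {vectorize (block_row n k D) | D. \<forall>j<k. D j \<in> S j}"
proof -
  have dims: "dim_row A = n * n" if "A \<in> set (map (\<lambda>j. basis_mat n (B j)) [0..<k])" for A
    using that basis_mat_carrier by auto
  have range: "(\<exists>x\<in>carrier_vec (dim_col P). P *\<^sub>v x = y)
      \<longleftrightarrow> (\<forall>j<k. Matrix.vec (n * n) (\<lambda>i. y $ (j * (n * n) + i)) \<in> vectorize ` S j)"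
    if "y \<in> carrier_vec (k * (n * n))" for y
  proof -
    have "dim_col (basis_mat n (B j)) = length (B j)" for j
      using basis_mat_carrier by blast
    then show ?thesis
      using diag_block_mat_range[of "map (\<lambda>j. basis_mat n (B j)) [0..<k]" "n * n" y, folded P] dims that
        basis_mat_range[OF S B] by simp
  qed
  have carr: "S j \<subseteq> carrier_mat n n" if "j < k" for j
    using subspace_matD(1)[OF S[OF that]] .
  have vcar: "vectorize (block_row n k D) \<in> carrier_vec (k * (n * n))" for D
    using vectorize_carrier[OF block_row_carrier[of n k D]] by (simp add: mult.assoc)
  have block: "vectorize (block_row n k D) $ (j * (n * n) + (b * n + a)) = D j $$ (a, b)"
    if "j < k" "a < n" "b < n" for D j a b
  proof -
    \<comment> \<open>The same position, read first by block and then within it, or by column of the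
      whole block row.\<close>
    have eq: "j * (n * n) + (b * n + a) = (j * n + b) * n + a" by (simp add: algebra_simps)
    show ?thesis
      unfolding eq using vectorize_index[OF block_row_carrier[of n k D], of a "j * n + b"] that
        index_block_less[of j k b n] by (simp add: block_row_index)
  qed
  have blocks: "Matrix.vec (n * n) (\<lambda>i. vectorize (block_row n k D) $ (j * (n * n) + i)) = vectorize (D j)"
    if "j < k" "D j \<in> carrier_mat n n" for D j
  proof (rule vec_eq_blockwiseI[of _ n n])
    fix b a assume "b < n" "a < n"
    then show "Matrix.vec (n * n) (\<lambda>i. vectorize (block_row n k D) $ (j * (n * n) + i)) $ (b * n + a)
        = vectorize (D j) $ (b * n + a)"
      using that index_block_less[of b n a n] by (simp add: block vectorize_index)
  qed (use vectorize_carrier[OF that(2)] in auto)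
  have Pdim: "dim_row P = k * (n * n)"
  proof -
    have "map dim_row (map (\<lambda>j. basis_mat n (B j)) [0..<k]) = replicate k (n * n)"
      using basis_mat_carrier by (intro nth_equalityI) auto
    then show ?thesis by (simp only: P dim_diag_block_mat sum_list_replicate) simp
  qed
  show ?thesis
  proof (intro equalityI subsetI)
    fix y assume "y \<in> {P *\<^sub>v x | x. x \<in> carrier_vec (dim_col P)}"
    then obtain x where x: "x \<in> carrier_vec (dim_col P)" "y = P *\<^sub>v x" by auto
    have y: "y \<in> carrier_vec (k * (n * n))"
      by (rule carrier_vecI) (simp add: x(2) Pdim)
    then have "\<forall>j<k. Matrix.vec (n * n) (\<lambda>i. y $ (j * (n * n) + i)) \<in> vectorize ` S j"
      using range x by blast
    then have "\<forall>j. \<exists>D. j < k \<longrightarrow> D \<in> S j \<and> Matrix.vec (n * n) (\<lambda>i. y $ (j * (n * n) + i)) = vectorize D"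
      by blast
    then obtain D where D: "\<And>j. j < k \<Longrightarrow> D j \<in> S j"
      "\<And>j. j < k \<Longrightarrow> Matrix.vec (n * n) (\<lambda>i. y $ (j * (n * n) + i)) = vectorize (D j)"
      by metis
    have "y = vectorize (block_row n k D)"
    proof (rule vec_eq_blockwiseI[OF y vcar])
      fix j i assume ji: "j < k" "i < n * n"
      have "Matrix.vec (n * n) (\<lambda>i. y $ (j * (n * n) + i)) $ i
          = Matrix.vec (n * n) (\<lambda>i. vectorize (block_row n k D) $ (j * (n * n) + i)) $ i"
        using D(2)[OF ji(1)] blocks[OF ji(1), of D] D(1)[OF ji(1)] carr[OF ji(1)] by auto
      then show "y $ (j * (n * n) + i) = vectorize (block_row n k D) $ (j * (n * n) + i)"
        using ji(2) by simp
    qed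
    then show "y \<in> {vectorize (block_row n k D) | D. \<forall>j<k. D j \<in> S j}"
      using D(1) by auto
  next
    fix y assume "y \<in> {vectorize (block_row n k D) | D. \<forall>j<k. D j \<in> S j}"
    then obtain D where D: "\<forall>j<k. D j \<in> S j" "y = vectorize (block_row n k D)" by auto
    have "Matrix.vec (n * n) (\<lambda>i. y $ (j * (n * n) + i)) \<in> vectorize ` S j" if "j < k" for j
      using blocks[OF that, of D] D carr[OF that] that by auto
    then have "\<exists>x\<in>carrier_vec (dim_col P). P *\<^sub>v x = y"
      using range[of y] vcar D(2) by auto
    then show "y \<in> {P *\<^sub>v x | x. x \<in> carrier_vec (dim_col P)}"
      by blast
  qed
qed

theorem theorem3p2:
  fixes n k p :: nat
    and S :: "nat \<Rightarrow> complex mat set"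
    and B :: "nat \<Rightarrow> complex mat list"
    and F :: "nat \<Rightarrow> complex mat"
    and f :: "nat \<Rightarrow> complex \<Rightarrow> complex"
    and lam :: "nat \<Rightarrow> complex"
    and V G P M R :: "complex mat"
    and r :: "complex vec"
    and eta :: real
  assumes "\<And>j. j < k \<Longrightarrow> VectorSpace.subspace class_ring (S j) (module_mat TYPE(complex) n n)"
    and "\<And>j. j < k \<Longrightarrow> F j \<in> S j"
    and "V \<in> carrier_mat n p"
    and "\<And>i. i < p \<Longrightarrow> col V i \<noteq> 0\<^sub>v n"
    and "\<And>j. j < k \<Longrightarrow> orthonormal_basis n (S j) (B j)"
    and "R = residual n p k f V lam F"
    and "r = vectorize R"
    and "G = Matrix.mat p k (\<lambda>(i, j). f j (lam i))"
    and "P = diag_block_mat (map (\<lambda>j. basis_mat n (B j)) [0..<k])"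
    and "M = kronecker (khatri_rao_T G (transpose_mat V)) (1\<^sub>m n) * P"
    and "eta = struct_backward_error n p k S f V lam F"
  shows "eta \<in> perturbation_norms n p k S f V lam F
       \<and> (\<forall>x \<in> perturbation_norms n p k S f V lam F. eta \<le> x)
       \<and> eta = vec_norm2 (pinv M *\<^sub>v r)
       \<and> (sigma_min M \<noteq> 0 \<longrightarrow> eta \<le> inverse (sigma_min M) * frob_norm R)"
proof -
  note S = assms(1) and F = assms(2) and V = assms(3) and B = assms(5) and R = assms(6)
    and r = assms(7) and G = assms(8) and P = assms(9) and M = assms(10) and eta = assms(11)
  define K where "K = kronecker (khatri_rao_T G (transpose_mat V)) (1\<^sub>m n)"
  define d where "d = dim_col P"
  have range: "{P *\<^sub>v x | x. x \<in> carrier_vec d} = {vectorize (block_row n k D) | D. \<forall>j<k. D j \<in> S j}"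
    unfolding d_def by (rule block_basis_range[OF S B P])
  have car: "A j \<in> carrier_mat n n" if "\<forall>j<k. A j \<in> S j" "j < k" for A j
    using that subspace_matD(1)[OF S[OF that(2)]] by auto
  have PP: "mat_adjoint P * P = 1\<^sub>m d"
    unfolding P d_def
  proof (rule diag_block_mat_isometry)
    fix A assume "A \<in> set (map (\<lambda>j. basis_mat n (B j)) [0..<k])"
    then obtain j where "j < k" "A = basis_mat n (B j)" by auto
    then show "mat_adjoint A * A = 1\<^sub>m (dim_col A)"
      using basis_mat_isometry[OF S B] basis_mat_carrier[of n "B j"] by auto
  qed
  have isom: "vec_norm2 (P *\<^sub>v x) = vec_norm2 x" if "x \<in> carrier_vec d" for x
    by (rule vec_norm2_isometry[OF _ that PP]) (rule carrier_matI, simp_all add: d_def)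
  have coord: "\<exists>x. x \<in> carrier_vec d \<and> P *\<^sub>v x = vectorize (block_row n k A)" if "\<forall>j<k. A j \<in> S j" for A
  proof -
    have "vectorize (block_row n k A) \<in> {P *\<^sub>v x | x. x \<in> carrier_vec d}"
      unfolding range using that by blast
    then show ?thesis by auto
  qed
  have pert: "\<exists>A. (\<forall>j<k. A j \<in> S j) \<and> P *\<^sub>v x = vectorize (block_row n k A)" if "x \<in> carrier_vec d" for x
  proof -
    have "P *\<^sub>v x \<in> {vectorize (block_row n k D) | D. \<forall>j<k. D j \<in> S j}"
      unfolding range[symmetric] using that by blast
    then show ?thesis by auto
  qed
  \<comment> \<open>The row count is read off from the length of one vector in the range.\<close>
  have Pdim: "dim_row P = k * n * n"
  proof -
    obtain D where "P *\<^sub>v 0\<^sub>v d = vectorize (block_row n k D)"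
      using pert[of "0\<^sub>v d"] by auto
    then have "dim_vec (P *\<^sub>v 0\<^sub>v d) = k * n * n"
      using vectorize_carrier[OF block_row_carrier[of n k D]] by auto
    then show ?thesis by simp
  qed
  have Pc: "P \<in> carrier_mat (k * n * n) d"
    by (rule carrier_matI) (simp_all add: Pdim d_def)
  have Kc: "K \<in> carrier_mat (p * n) (k * n * n)"
    unfolding K_def by (rule carrier_matI) (use V in \<open>simp_all add: kronecker_def khatri_rao_T_def G\<close>)
  have Mc: "M \<in> carrier_mat (p * n) d"
    unfolding M K_def[symmetric] by (rule mult_carrier_mat[OF Kc Pc])
  have M_eq: "M *\<^sub>v x = vectorize (residual n p k f V lam A)"
    if "x \<in> carrier_vec d" "P *\<^sub>v x = vectorize (block_row n k A)" "\<forall>j<k. A j \<in> S j" for x A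
  proof -
    have "M *\<^sub>v x = K *\<^sub>v vectorize (block_row n k A)"
      unfolding M K_def[symmetric] assoc_mult_mat_vec[OF Kc Pc that(1)] that(2) ..
    also have "\<dots> = vectorize (residual n p k f V lam A)"
      unfolding K_def by (rule kronecker_khatri_rao_vectorize[OF V car[OF that(3)] G])
    finally show ?thesis .
  qed
  have Fj: "\<forall>j<k. F j \<in> S j" using F by simp
  note resc = residual_carrier[OF V, of k]
  have Rc: "R \<in> carrier_mat n p" unfolding R by (rule resc) (rule car[OF Fj])
  have rc: "r \<in> carrier_vec (p * n)" unfolding r by (rule vectorize_carrier[OF Rc])
  \<comment> \<open>Additivity splits the constraint into \<open>R\<close> plus the residual of the
    perturbation, whose vectorisation is \<open>M x\<close>.\<close>
  have feasible: "residual n p k f V lam (\<lambda>j. F j + A j) = 0\<^sub>m n p \<longleftrightarrow> M *\<^sub>v x = - r"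
    if x: "x \<in> carrier_vec d" "P *\<^sub>v x = vectorize (block_row n k A)" and A: "\<forall>j<k. A j \<in> S j" for x A
  proof -
    have Ac: "residual n p k f V lam A \<in> carrier_mat n p" by (rule resc) (rule car[OF A])
    have "residual n p k f V lam (\<lambda>j. F j + A j) = R + residual n p k f V lam A"
      unfolding R by (rule residual_add[OF V car[OF Fj] car[OF A]])
    then have "residual n p k f V lam (\<lambda>j. F j + A j) = 0\<^sub>m n p
        \<longleftrightarrow> vectorize (R + residual n p k f V lam A) = vectorize (0\<^sub>m n p)"
      using vectorize_eq_iff[of "R + residual n p k f V lam A" n p "0\<^sub>m n p"] Rc Ac by simp
    also have "\<dots> \<longleftrightarrow> r + M *\<^sub>v x = 0\<^sub>v (p * n)"
      unfolding vectorize_add[OF Rc Ac] vectorize_zero M_eq[OF x A] r ..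
    also have "\<dots> \<longleftrightarrow> M *\<^sub>v x = - r"
    proof
      assume eq: "r + M *\<^sub>v x = 0\<^sub>v (p * n)"
      show "M *\<^sub>v x = - r"
      proof (rule eq_vecI)
        fix i assume "i < dim_vec (- r)"
        then show "(M *\<^sub>v x) $ i = (- r) $ i"
          using arg_cong[OF eq, of "\<lambda>v. v $ i"] rc carrier_matD(1)[OF Mc]
          by (simp add: add_eq_0_iff del: index_mult_mat_vec)
      qed (use rc Mc in simp)
    qed (use rc in simp)
    finally show ?thesis .
  qed
  \<comment> \<open>Coordinates with respect to \<open>P\<close> preserve the norm, so the problem
    becomes that of the norms of solutions of \<open>M x = - r\<close>.\<close>
  have norms: "perturbation_norms n p k S f V lam F = {vec_norm2 x | x. x \<in> carrier_vec d \<and> M *\<^sub>v x = - r}"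
  proof (intro equalityI subsetI)
    fix t assume "t \<in> perturbation_norms n p k S f V lam F"
    then obtain A where A: "t = frob_norm (block_row n k A)" "\<forall>j<k. A j \<in> S j"
      "residual n p k f V lam (\<lambda>j. F j + A j) = 0\<^sub>m n p"
      by (auto simp: perturbation_norms_def)
    obtain x where x: "x \<in> carrier_vec d" "P *\<^sub>v x = vectorize (block_row n k A)"
      using coord[OF A(2)] by auto
    show "t \<in> {vec_norm2 x | x. x \<in> carrier_vec d \<and> M *\<^sub>v x = - r}"
      using A feasible[OF x A(2)] isom[OF x(1)] x by (auto simp: frob_norm_vectorize)
  next
    fix t assume "t \<in> {vec_norm2 x | x. x \<in> carrier_vec d \<and> M *\<^sub>v x = - r}"
    then obtain x where x: "t = vec_norm2 x" "x \<in> carrier_vec d" "M *\<^sub>v x = - r" by auto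
    obtain A where A: "\<forall>j<k. A j \<in> S j" "P *\<^sub>v x = vectorize (block_row n k A)"
      using pert[OF x(2)] by auto
    show "t \<in> perturbation_norms n p k S f V lam F"
      unfolding perturbation_norms_def
      using feasible[OF x(2) A(2,1)] x A isom[OF x(2)]
      by (intro CollectI exI[of _ A]) (simp add: frob_norm_vectorize)
  qed
  \<comment> \<open>Coordinates of \<open>F\<close> itself. They show that \<open>r\<close> lies in
    the range of \<open>M\<close>, so the system is consistent.\<close>
  obtain c where c: "c \<in> carrier_vec d" "P *\<^sub>v c = vectorize (block_row n k F)"
    using coord[OF Fj] by auto
  have rM: "r = M *\<^sub>v c"
    unfolding M_eq[OF c Fj] r R ..
  have X: "pinv M \<in> carrier_mat d (p * n)" by (rule pinv_carrier[OF Mc])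
  \<comment> \<open>The minus sign comes from the right-hand side \<open>- r\<close>; it does not
    affect the norm.\<close>
  define x0 where "x0 = - (pinv M *\<^sub>v r)"
  have x0: "x0 \<in> carrier_vec d" using X rc by (simp add: x0_def)
  have Mx0: "M *\<^sub>v x0 = - r"
    using uminus_mult_mat_vec_right[OF Mc, of "pinv M *\<^sub>v r"] mult_pinv_image[OF Mc c(1)] X rc
    by (simp add: x0_def rM)
  have mem: "vec_norm2 (pinv M *\<^sub>v r) \<in> perturbation_norms n p k S f V lam F"
    unfolding norms using x0 Mx0 by (auto simp: x0_def intro!: exI[of _ x0])
  have min: "vec_norm2 (pinv M *\<^sub>v r) \<le> t" if t: "t \<in> perturbation_norms n p k S f V lam F" for t
  proof -
    obtain x where x: "t = vec_norm2 x" "x \<in> carrier_vec d" "M *\<^sub>v x = - r"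
      using t unfolding norms by auto
    have "vec_norm2 (pinv M *\<^sub>v (- r)) \<le> t"
      using pinv_minimal_norm[OF Mc x(2)] x by simp
    then show ?thesis
      by (simp add: uminus_mult_mat_vec_right[OF X rc])
  qed
  \<comment> \<open>The candidate value is attained and is a lower bound, so \<open>LEAST\<close>
    returns it.\<close>
  have eta_eq: "eta = vec_norm2 (pinv M *\<^sub>v r)"
    unfolding eta struct_backward_error_def by (rule Least_equality) (use mem min in auto)
  show ?thesis
    using mem min pinv_norm_le[OF Mc c(1)] by (auto simp: eta_eq frob_norm_vectorize rM simp flip: r)
qed

end
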